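(* Let $s\ge q>1$, $b>0$ and $A>0$, let $\mathcal{Y}=\mathbb{R}$ and let the loss be $\ell(y,y')=|y-y'|^q$. There is a quantity $C>0$ depending only on the real numbers $b$, $A$, $q$ and $s$ such that the following holds. For any $d\in\mathbb{N}^*$, any training set size $n\in\mathbb{N}^*$ and any input space $\mathcal{X}$ containing at least $\lfloor\log_2(2d)\rfloor$ points, there exists a set $\mathcal{G}$ of $d$ prediction functions uniformly bounded by $b$ such that: for any estimator $\hat g$ there exists a probability distribution on the data space $\mathcal{X}\times\mathbb{R}$ for which $\mathbb{E}|Y|^s\le A$ and both inequalities $$\mathbb{E}R(\hat g)-\min_{g\in\mathcal{G}}R(g)\ge C\left(\frac{\log|\mathcal{G}|}{n}\wedge1\right)^{1-(q-1)/s}$$ and $$\mathbb{E}R(\hat g)-\min_{g\in\mathcal{G}}R(g)\ge C\left(\frac{\log|\mathcal{G}|}{n}\wedge1\right)^{1-q/(s+2)}$$ hold.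
   Context: Prediction functions are (measurable) functions $\mathcal{X}\to\mathbb{R}$. For a distribution $P$ on $\mathcal{X}\times\mathbb{R}$, $R(g)=\mathbb{E}_{(X,Y)\sim P}|Y-g(X)|^q$. An estimator $\hat g$ maps a training set $Z_1^n\in(\mathcal{X}\times\mathbb{R})^n$ to a prediction function $\hat g_{Z_1^n}$; $\mathbb{E}R(\hat g)=\mathbb{E}_{Z_1^n\sim P^{\otimes n}}R(\hat g_{Z_1^n})$. $\lfloor x\rfloor$ is the largest integer not exceeding $x$, $a\wedge b=\min(a,b)$, and $|\mathcal{G}|=d$ is the cardinality of $\mathcal{G}$. Measurability of the manipulated quantities is implicitly assumed. *)

theory Defs
  imports "HOL-Probability.Probability"
begin

text \<open>
  An input space is a measurable space; it is represented by a measure \<open>M\<close> of which only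
  \<open>space M\<close> and \<open>sets M\<close> matter.  Prediction functions are extensional, so that distinct
  members of a set of prediction functions differ somewhere on \<open>space M\<close> and \<open>card\<close> counts
  functions on the input space.
\<close>

definition prediction_functions :: "'a measure \<Rightarrow> ('a \<Rightarrow> real) set" where
  "prediction_functions M = borel_measurable M \<inter> extensional (space M)"

definition data_distributions :: "'a measure \<Rightarrow> ('a \<times> real) measure set" where
  "data_distributions M = {P. prob_space P \<and> sets P = sets (M \<Otimes>\<^sub>M borel)}"

text \<open>
  Expectations of nonnegative quantities are Lebesgue integrals with values in \<open>[0, \<infinity>]\<close>, because
  the risk of an estimator may be infinite.
\<close>

definition risk :: "real \<Rightarrow> ('a \<times> real) measure \<Rightarrow> ('a \<Rightarrow> real) \<Rightarrow> ennreal" where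
  "risk q P g = (\<integral>\<^sup>+ (x, y). ennreal (\<bar>y - g x\<bar> powr q) \<partial>P)"

definition output_moment :: "real \<Rightarrow> ('a \<times> real) measure \<Rightarrow> ennreal" where
  "output_moment s P = (\<integral>\<^sup>+ (x, y). ennreal (\<bar>y\<bar> powr s) \<partial>P)"

definition sample_dist :: "nat \<Rightarrow> ('a \<times> real) measure \<Rightarrow> (nat \<Rightarrow> 'a \<times> real) measure" where
  "sample_dist n P = Pi\<^sub>M {..<n} (\<lambda>_. P)"

text \<open>
  Measurability of an estimator is joint measurability in the training set and the input; it makes
  each \<open>ghat z\<close> a measurable function and \<open>risk q P (ghat z)\<close> a measurable function of \<open>z\<close>.
\<close>

definition estimators :: "'a measure \<Rightarrow> nat \<Rightarrow> ((nat \<Rightarrow> 'a \<times> real) \<Rightarrow> 'a \<Rightarrow> real) set" where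
  "estimators M n =
    {ghat. (\<lambda>(z, x). ghat z x) \<in> borel_measurable (Pi\<^sub>M {..<n} (\<lambda>_. M \<Otimes>\<^sub>M borel) \<Otimes>\<^sub>M M)}"

definition expected_risk ::
  "real \<Rightarrow> nat \<Rightarrow> ('a \<times> real) measure \<Rightarrow> ((nat \<Rightarrow> 'a \<times> real) \<Rightarrow> 'a \<Rightarrow> real) \<Rightarrow> ennreal" where
  "expected_risk q n P ghat = (\<integral>\<^sup>+ z. risk q P (ghat z) \<partial>sample_dist n P)"

text \<open>
  The difference is taken in the extended reals, where it can be negative (subtraction on
  \<open>ennreal\<close> truncates at 0).  The subtracted minimum is finite whenever \<open>G\<close> is uniformly bounded,
  \<open>output_moment s P\<close> is finite and \<open>s \<ge> q\<close>.
\<close>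

definition excess_risk ::
  "real \<Rightarrow> nat \<Rightarrow> ('a \<times> real) measure \<Rightarrow> ('a \<Rightarrow> real) set
    \<Rightarrow> ((nat \<Rightarrow> 'a \<times> real) \<Rightarrow> 'a \<Rightarrow> real) \<Rightarrow> ereal" where
  "excess_risk q n P G ghat =
    enn2ereal (expected_risk q n P ghat) - enn2ereal (Min (risk q P ` G))"

text \<open>
  Points that no measurable set tells apart are one point for all measurable functions (with the
  trivial \<open>\<sigma>\<close>-algebra only constants are measurable), so the counted points are required to be
  separated by measurable sets.  This holds for any points if singletons are measurable.
\<close>

definition contains_points :: "'a measure \<Rightarrow> int \<Rightarrow> bool" where
  "contains_points M k \<longleftrightarrow>
    (\<exists>S \<subseteq> space M. finite S \<and> int (card S) \<ge> k \<and>
      (\<forall>x\<in>S. \<forall>y\<in>S. x \<noteq> y \<longrightarrow> (\<exists>B\<in>sets M. x \<in> B \<and> y \<notin> B)))"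

definition lower_bound_holds ::
  "real \<Rightarrow> real \<Rightarrow> real \<Rightarrow> real \<Rightarrow> real \<Rightarrow> nat \<Rightarrow> nat \<Rightarrow> 'a measure \<Rightarrow> bool" where
  "lower_bound_holds C b A q s d n M \<longleftrightarrow>
    (\<exists>G \<subseteq> prediction_functions M.
      finite G \<and> card G = d \<and> (\<forall>g\<in>G. \<forall>x\<in>space M. \<bar>g x\<bar> \<le> b) \<and>
      (\<forall>ghat \<in> estimators M n. \<exists>P \<in> data_distributions M.
        output_moment s P \<le> ennreal A \<and>
        excess_risk q n P G ghat
          \<ge> ereal (C * min (ln (real (card G)) / real n) 1 powr (1 - (q - 1) / s)) \<and>
        excess_risk q n P G ghat
          \<ge> ereal (C * min (ln (real (card G)) / real n) 1 powr (1 - q / (s + 2)))))"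

text \<open>
  The constant must not depend on the input space, hence not on the type of its points either, but
  \<open>\<exists>C. \<forall>M :: 'a measure. \<dots>\<close> in a theorem with \<open>'a\<close> free would allow a different \<open>C\<close> for each
  \<open>'a\<close>, and HOL cannot quantify over types below an existential.  So the constant is a function of
  \<open>b\<close>, \<open>A\<close>, \<open>q\<close>, \<open>s\<close> alone, picked as some positive number that works for the input spaces of
  natural numbers.  That such a number exists, and that it works for the input spaces over every
  other type, is not part of the definition and has to be proved.
\<close>

definition lower_bound_const :: "real \<Rightarrow> real \<Rightarrow> real \<Rightarrow> real \<Rightarrow> real" where
  "lower_bound_const b A q s =
    (SOME C. C > 0 \<and>
      (\<forall>d \<ge> 1. \<forall>n \<ge> 1. \<forall>M :: nat measure.
        contains_points M \<lfloor>log 2 (2 * real d)\<rfloor> \<longrightarrow> lower_bound_holds C b A q s d n M))"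

end

theory Submission
  imports Defs
begin

text \<open>
  Let \<open>k = \<lfloor>log 2 d\<rfloor>\<close>. Assouad's method is applied to a cube of \<open>2 ^ k\<close> finitely supported
  distributions: the input is one of \<open>k\<close> points of mass \<open>w / k\<close>, or an uninformative further point,
  and at each of the \<open>k\<close> points the output follows a law \<open>mu\<close> or its reflection \<open>y \<mapsto> - y\<close>,
  with optimal predictions \<open>h\<close> and \<open>- h\<close>. If \<open>n\<close> observations do not tell \<open>mu\<close> from its
  reflection at a given point, which is quantified by the Hellinger affinity, then by convexity and
  symmetry an estimator does on average no better than predicting \<open>0\<close>, and loses \<open>w\<close> times the gap
  between the mean losses of \<open>0\<close> and \<open>h\<close>. With \<open>t = min (ln d / n) 1\<close> it suffices that
  \<open>w\<close> times the defect of the affinity is at most \<open>t / 8\<close>. The rate with exponent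
  \<open>1 - (q - 1) / s\<close> comes from a law that is \<open>0\<close> except for rare huge values, the rate with exponent
  \<open>1 - q / (s + 2)\<close> from a slightly biased law on \<open>{- B, B}\<close>. As \<open>t \<le> 1\<close>, the better of the two
  rates implies the other one.
\<close>

section \<open>Transport of the lower bound along retractions\<close>

lemma risk_cong: "(\<And>x. x \<in> space M \<Longrightarrow> f x = g x) \<Longrightarrow> P \<in> data_distributions M \<Longrightarrow> risk q P f = risk q P g"
  unfolding risk_def data_distributions_def
  by (intro nn_integral_cong) (auto dest!: sets_eq_imp_space_eq simp: space_pair_measure)

lemma estimator_measurable:
  assumes "ghat \<in> estimators M n" "z \<in> space (Pi\<^sub>M {..<n} (\<lambda>_. M \<Otimes>\<^sub>M borel))"
  shows "ghat z \<in> borel_measurable M"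
proof -
  have "(\<lambda>(z, x). ghat z x) \<in> borel_measurable (Pi\<^sub>M {..<n} (\<lambda>_. M \<Otimes>\<^sub>M borel) \<Otimes>\<^sub>M M)"
    using assms(1) by (simp add: estimators_def)
  from measurable_Pair2[OF this assms(2)] show ?thesis by simp
qed

lemma risk_estimator_measurable:
  assumes ghat: "ghat \<in> estimators M n" and P: "P \<in> data_distributions M"
  shows "(\<lambda>z. risk q P (ghat z)) \<in> borel_measurable (Pi\<^sub>M {..<n} (\<lambda>_. M \<Otimes>\<^sub>M borel))"
proof -
  let ?S = "Pi\<^sub>M {..<n} (\<lambda>_. M \<Otimes>\<^sub>M borel)"
  have g: "(\<lambda>(z, x). ghat z x) \<in> borel_measurable (?S \<Otimes>\<^sub>M M)"
    using ghat by (simp add: estimators_def)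
  have sets_P[measurable_cong]: "sets P = sets (M \<Otimes>\<^sub>M borel)" and "prob_space P"
    using P by (simp_all add: data_distributions_def)
  interpret prob_space P by fact
  have [measurable]: "(\<lambda>w. ghat (fst w) (fst (snd w))) \<in> borel_measurable (?S \<Otimes>\<^sub>M (M \<Otimes>\<^sub>M borel))"
    using measurable_compose[OF _ g, of "\<lambda>w. (fst w, fst (snd w))" "?S \<Otimes>\<^sub>M (M \<Otimes>\<^sub>M borel)"] by simp
  have "(\<lambda>(z, w). ennreal (\<bar>snd w - ghat z (fst w)\<bar> powr q)) \<in> borel_measurable (?S \<Otimes>\<^sub>M (M \<Otimes>\<^sub>M borel))"
    unfolding case_prod_beta by measurable
  hence "(\<lambda>(z, w). ennreal (\<bar>snd w - ghat z (fst w)\<bar> powr q)) \<in> borel_measurable (?S \<Otimes>\<^sub>M P)"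
    by (simp add: sets_P cong: measurable_cong_sets)
  thus ?thesis unfolding risk_def case_prod_beta by (intro borel_measurable_nn_integral) (simp add: case_prod_beta)
qed

lemma risk_distr:
  assumes P: "P \<in> data_distributions N" and psi[measurable]: "psi \<in> measurable N M"
    and [measurable]: "g \<in> borel_measurable M"
  shows "risk q (distr P (M \<Otimes>\<^sub>M borel) (map_prod psi id)) g = risk q P (g \<circ> psi)"
proof -
  have [measurable_cong]: "sets P = sets (N \<Otimes>\<^sub>M borel)" using P by (simp add: data_distributions_def)
  have "map_prod psi id \<in> measurable P (M \<Otimes>\<^sub>M borel)"
    unfolding map_prod_def case_prod_beta by simp
  thus ?thesis unfolding risk_def case_prod_beta by (subst nn_integral_distr) auto
qed

text \<open>Functions in \<open>G'\<close> are pulled back along \<open>phi\<close>, distributions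
  pushed forward along \<open>psi\<close>. An estimator on \<open>M\<close>, fed with samples moved
  by \<open>psi\<close> and evaluated at \<open>psi i\<close>, is an estimator on \<open>N\<close>,
  and \<open>phi (psi i) = i\<close> makes all risks agree.\<close>

lemma lower_bound_holds_retract:
  fixes M :: "'a measure" and N :: "'b measure"
  assumes lb: "lower_bound_holds C b A q s d n N"
    and phi[measurable]: "phi \<in> measurable M N" and psi[measurable]: "psi \<in> measurable N M"
    and inv: "\<And>i. i \<in> space N \<Longrightarrow> phi (psi i) = i"
  shows "lower_bound_holds C b A q s d n M"
proof -
  obtain G' where G': "G' \<subseteq> prediction_functions N" "finite G'" "card G' = d"
      "\<And>g x. g \<in> G' \<Longrightarrow> x \<in> space N \<Longrightarrow> \<bar>g x\<bar> \<le> b"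
    and low: "\<And>ghat. ghat \<in> estimators N n \<Longrightarrow> \<exists>P \<in> data_distributions N.
        output_moment s P \<le> ennreal A \<and>
        excess_risk q n P G' ghat
          \<ge> ereal (C * min (ln (real (card G')) / real n) 1 powr (1 - (q - 1) / s)) \<and>
        excess_risk q n P G' ghat
          \<ge> ereal (C * min (ln (real (card G')) / real n) 1 powr (1 - q / (s + 2)))"
    using lb unfolding lower_bound_holds_def by blast
  define lift where "lift g = restrict (g \<circ> phi) (space M)" for g :: "'b \<Rightarrow> real"
  define shift where "shift = (map_prod psi id :: 'b \<times> real \<Rightarrow> 'a \<times> real)"
  have shift[measurable]: "shift \<in> measurable (N \<Otimes>\<^sub>M borel) (M \<Otimes>\<^sub>M borel)"
    unfolding map_prod_def case_prod_beta shift_def by simp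
  have lift_psi: "lift g (psi i) = g i" if "i \<in> space N" for g i
    using that measurable_space[OF psi] by (simp add: lift_def inv)
  have lift_measurable: "lift g \<in> borel_measurable M" if "g \<in> G'" for g
  proof -
    have [measurable]: "g \<in> borel_measurable N" using that G'(1) by (auto simp: prediction_functions_def)
    have "lift g \<in> borel_measurable M \<longleftrightarrow> g \<circ> phi \<in> borel_measurable M"
      by (rule measurable_cong) (simp add: lift_def)
    thus ?thesis by simp
  qed
  \<comment> \<open>On \<open>space N\<close>, composing with \<open>psi\<close> recovers
    \<open>g\<close> from \<open>lift g\<close>, so the cardinality \<open>d\<close>
    survives.\<close>
  have "inj_on lift G'"
  proof (rule inj_onI)
    fix f g assume *: "f \<in> G'" "g \<in> G'" "lift f = lift g"
    show "f = g"
    proof (rule extensionalityI[of _ "space N"])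
      fix i assume "i \<in> space N"
      thus "f i = g i" using * lift_psi by metis
    qed (use * G'(1) in \<open>auto simp: prediction_functions_def\<close>)
  qed
  hence card: "card (lift ` G') = d" using G' by (simp add: card_image)
  show ?thesis unfolding lower_bound_holds_def
  proof (intro exI[of _ "lift ` G'"] conjI ballI)
    show "lift ` G' \<subseteq> prediction_functions M"
      using lift_measurable by (auto simp: prediction_functions_def lift_def)
  next
    fix g x assume "g \<in> lift ` G'" "x \<in> space M"
    thus "\<bar>g x\<bar> \<le> b" using G'(4) measurable_space[OF phi] by (auto simp: lift_def)
  next
    fix ghat assume ghat: "ghat \<in> estimators M n"
    define sh where "sh = (\<lambda>z. \<lambda>j\<in>{..<n}. shift (z j))"
    define ghat' where "ghat' = (\<lambda>z i. ghat (sh z) (psi i))"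
    let ?SN = "Pi\<^sub>M {..<n} (\<lambda>_. N \<Otimes>\<^sub>M (borel :: real measure))"
    let ?SM = "Pi\<^sub>M {..<n} (\<lambda>_. M \<Otimes>\<^sub>M (borel :: real measure))"
    have sh[measurable]: "sh \<in> measurable ?SN ?SM"
      unfolding sh_def by measurable
    have g: "(\<lambda>(z, x). ghat z x) \<in> borel_measurable (?SM \<Otimes>\<^sub>M M)"
      using ghat by (simp add: estimators_def)
    have "ghat' \<in> estimators N n"
      using measurable_compose[OF _ g, of "\<lambda>w. (sh (fst w), psi (snd w))" "?SN \<Otimes>\<^sub>M N"]
      by (simp add: estimators_def ghat'_def case_prod_beta)
    then obtain P where P: "P \<in> data_distributions N" "output_moment s P \<le> ennreal A"
        "excess_risk q n P G' ghat'
          \<ge> ereal (C * min (ln (real d) / real n) 1 powr (1 - (q - 1) / s))"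
        "excess_risk q n P G' ghat'
          \<ge> ereal (C * min (ln (real d) / real n) 1 powr (1 - q / (s + 2)))"
      using low[of ghat'] G' by auto
    define Q where "Q = distr P (M \<Otimes>\<^sub>M borel) shift"
    have sets_P[measurable_cong]: "sets P = sets (N \<Otimes>\<^sub>M borel)" and "prob_space P"
      using P by (simp_all add: data_distributions_def)
    interpret prob_space P by fact
    have Q: "Q \<in> data_distributions M"
      by (auto simp: data_distributions_def Q_def intro!: prob_space_distr)
    have moment: "output_moment s Q = output_moment s P"
    proof -
      have "snd (shift v) = snd v" for v by (simp add: shift_def)
      thus ?thesis unfolding output_moment_def Q_def case_prod_beta by (subst nn_integral_distr) simp_all
    qed
    have risk_Q: "risk q Q g = risk q P (g \<circ> psi)" if "g \<in> borel_measurable M" for g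
      using risk_distr[OF P(1) psi that] by (simp add: Q_def shift_def)
    have "risk q Q (lift g) = risk q P g" if "g \<in> G'" for g
    proof -
      have "risk q Q (lift g) = risk q P (lift g \<circ> psi)" by (rule risk_Q) (rule lift_measurable[OF that])
      also have "\<dots> = risk q P g" by (rule risk_cong[OF _ P(1)]) (simp add: lift_psi)
      finally show ?thesis .
    qed
    hence Min: "risk q Q ` lift ` G' = risk q P ` G'"
      by (simp add: image_image)
    have sample: "sample_dist n Q = distr (sample_dist n P) ?SM sh"
    proof -
      have "distr (Pi\<^sub>M {..<n} (\<lambda>_. P)) (Pi\<^sub>M {..<n} (\<lambda>_. Q)) (compose {..<n} shift) = Pi\<^sub>M {..<n} (\<lambda>_. distr P Q shift)"
        using \<open>prob_space P\<close> Q
        by (intro distr_PiM_finite_prob_space') (auto simp: data_distributions_def cong: measurable_cong_sets)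
      moreover have "distr P Q shift = Q" unfolding Q_def by (rule distr_cong) auto
      moreover have "sets (Pi\<^sub>M {..<n} (\<lambda>_. Q)) = sets ?SM"
        using Q by (intro sets_PiM_cong) (auto simp: data_distributions_def)
      moreover have "sh = compose {..<n} shift" by (simp add: sh_def compose_def fun_eq_iff)
      ultimately show ?thesis unfolding sample_dist_def by (metis distr_cong)
    qed
    have sets_S: "sets (sample_dist n P) = sets ?SN"
      unfolding sample_dist_def using sets_P by (intro sets_PiM_cong) auto
    have "expected_risk q n Q ghat = (\<integral>\<^sup>+ z. risk q Q (ghat (sh z)) \<partial>sample_dist n P)"
      unfolding expected_risk_def sample
      using sh risk_estimator_measurable[OF ghat Q]
      by (intro nn_integral_distr) (simp_all add: sets_S cong: measurable_cong_sets)
    also have "\<dots> = expected_risk q n P ghat'"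
      unfolding expected_risk_def
    proof (rule nn_integral_cong)
      fix z assume "z \<in> space (sample_dist n P)"
      hence "z \<in> space ?SN" using sets_eq_imp_space_eq[OF sets_S] by simp
      hence "sh z \<in> space ?SM" using sh by (rule measurable_space[rotated])
      from risk_Q[OF estimator_measurable[OF ghat this]]
      show "risk q Q (ghat (sh z)) = risk q P (ghat' z)" by (simp add: ghat'_def comp_def)
    qed
    finally have "excess_risk q n Q (lift ` G') ghat = excess_risk q n P G' ghat'"
      unfolding excess_risk_def Min by simp
    with P Q moment card show "\<exists>P\<in>data_distributions M. output_moment s P \<le> ennreal A \<and>
      excess_risk q n P (lift ` G') ghat
        \<ge> ereal (C * min (ln (real (card (lift ` G'))) / real n) 1 powr (1 - (q - 1) / s)) \<and>
      excess_risk q n P (lift ` G') ghat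
        \<ge> ereal (C * min (ln (real (card (lift ` G'))) / real n) 1 powr (1 - q / (s + 2)))"
      by (intro bexI[of _ Q]) simp_all
  qed (use G' card in auto)
qed

text \<open>Separated points have disjoint measurable cells around them; \<open>phi\<close> names
  the cell in which an input lies.\<close>

lemma contains_points_retract:
  assumes "contains_points M (int (Suc k))"
  obtains phi psi where "phi \<in> measurable M (count_space {..k})"
    "psi \<in> measurable (count_space {..k}) M" "\<And>i. i \<le> k \<Longrightarrow> phi (psi i) = i"
proof -
  obtain S where S: "S \<subseteq> space M" "finite S" "card S \<ge> Suc k"
      "\<forall>x\<in>S. \<forall>y\<in>S. x \<noteq> y \<longrightarrow> (\<exists>B\<in>sets M. x \<in> B \<and> y \<notin> B)"
    using assms by (force simp: contains_points_def)
  then obtain B where B: "\<And>x y. x \<in> S \<Longrightarrow> y \<in> S \<Longrightarrow> x \<noteq> y \<Longrightarrow> B x y \<in> sets M \<and> x \<in> B x y \<and> y \<notin> B x y"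
    by metis
  \<comment> \<open>Demanding both \<open>u \<in> B x y\<close> and \<open>u \<notin> B y x\<close>
    makes cells of distinct points disjoint even where the separating sets overlap.\<close>
  define cell where "cell x = {u \<in> space M. \<forall>y\<in>S - {x}. u \<in> B x y \<and> u \<notin> B y x}" for x
  have "{u \<in> space M. u \<in> B x y \<and> u \<notin> B y x} \<in> sets M" if "x \<in> S" "y \<in> S" "y \<noteq> x" for x y
  proof -
    have "{u \<in> space M. u \<in> B x y \<and> u \<notin> B y x} = B x y - B y x"
      using B[of x y] that sets.sets_into_space by blast
    thus ?thesis using B[of x y] B[of y x] that by auto
  qed
  hence cell: "cell x \<in> sets M" if "x \<in> S" for x
    unfolding cell_def using S(2) that by (intro sets.sets_Collect_finite_All) auto
  obtain T where T: "T \<subseteq> S" "card T = Suc k" using S(3) by (meson obtain_subset_with_card_n)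
  with S(2) have "finite T" by (auto intro: finite_subset)
  then obtain psi where psi: "bij_betw psi {..k} T"
    using ex_bij_betw_nat_finite[of T] T by (auto simp: atLeast0LessThan lessThan_Suc_atMost)
  have psi_S: "psi i \<in> S" if "i \<le> k" for i using bij_betw_apply[OF psi, of i] that T by auto
  have uniq: "i = j" if "i \<le> k" "j \<le> k" "u \<in> cell (psi i)" "u \<in> cell (psi j)" for i j u
  proof (rule ccontr)
    assume "i \<noteq> j"
    hence "psi i \<noteq> psi j" using psi that by (auto simp: bij_betw_def inj_on_def)
    moreover have "psi i \<in> S" "psi j \<in> S" using that psi_S by auto
    ultimately have "psi j \<in> S - {psi i}" "psi i \<in> S - {psi j}" by auto
    thus False using that(3,4) unfolding cell_def mem_Collect_eq by meson
  qed
  have in_cell: "psi i \<in> cell (psi i)" if "i \<le> k" for i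
    using psi_S[OF that] S(1) B by (auto simp: cell_def)
  \<comment> \<open>Outside all cells \<open>LEAST\<close> is unspecified; \<open>min k\<close>
    keeps the value in \<open>{..k}\<close>.\<close>
  define phi where "phi u = min k (LEAST i. i \<le> k \<and> u \<in> cell (psi i))" for u
  have "Measurable.pred M (\<lambda>u. i \<le> k \<and> u \<in> cell (psi i))" for i
    using cell[OF psi_S, of i] by (cases "i \<le> k") auto
  hence least: "(\<lambda>u. LEAST i. i \<le> k \<and> u \<in> cell (psi i)) \<in> measurable M (count_space UNIV)"
    by (rule measurable_Least)
  have phi_eq: "phi u = i" if "i \<le> k" "u \<in> cell (psi i)" for u i
  proof -
    have "(LEAST i. i \<le> k \<and> u \<in> cell (psi i)) = i"
      by (rule Least_equality) (use that uniq in auto)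
    thus ?thesis using that by (simp add: phi_def)
  qed
  show thesis
  proof
    show "phi \<in> measurable M (count_space {..k})"
      unfolding phi_def by (rule measurable_compose[OF least]) simp
    show "psi \<in> measurable (count_space {..k}) M" using psi_S S(1) by auto
    show "phi (psi i) = i" if "i \<le> k" for i using phi_eq in_cell that by blast
  qed
qed

section \<open>Finitely supported distributions\<close>

text \<open>The point measure lives on the power set of \<open>W\<close>; its image under the
  identity carries the \<sigma>-algebra of \<open>M\<close>, whether or not singletons are
  measurable there.\<close>

definition finite_dist :: "'a measure \<Rightarrow> ('a \<Rightarrow> real) \<Rightarrow> 'a set \<Rightarrow> 'a measure" where
  "finite_dist M p W = distr (point_measure W (\<lambda>v. ennreal (p v))) M (\<lambda>v. v)"

lemma sets_finite_dist [simp, measurable_cong]: "sets (finite_dist M p W) = sets M"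
  by (simp add: finite_dist_def)

lemma nn_integral_finite_dist:
  assumes "finite W" "W \<subseteq> space M" "f \<in> borel_measurable M"
  shows "(\<integral>\<^sup>+ v. f v \<partial>finite_dist M p W) = (\<Sum>v\<in>W. ennreal (p v) * f v)"
  unfolding finite_dist_def using assms
  by (subst nn_integral_distr) (auto simp: measurable_point_measure_eq1 nn_integral_point_measure_finite)

lemma prob_space_finite_dist:
  assumes "finite W" "W \<subseteq> space M" "\<And>v. v \<in> W \<Longrightarrow> p v \<ge> 0" "sum p W = 1"
  shows "prob_space (finite_dist M p W)"
proof
  have "emeasure (finite_dist M p W) (space (finite_dist M p W))
      = (\<integral>\<^sup>+ v. 1 \<partial>finite_dist M p W)" by simp
  also have "\<dots> = (\<Sum>v\<in>W. ennreal (p v))"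
    using assms nn_integral_finite_dist[of W M "\<lambda>_. 1" p] by simp
  also have "\<dots> = 1" using assms by (subst sum_ennreal) auto
  finally show "emeasure (finite_dist M p W) (space (finite_dist M p W)) = 1" .
qed

text \<open>Fubini's theorem splits off one coordinate at a time. The expected risk thereby becomes
  a finite sum over samples.\<close>

lemma nn_integral_PiM_finite_dist:
  assumes W: "finite W" "W \<subseteq> space M" "\<And>v. v \<in> W \<Longrightarrow> p v \<ge> 0" "sum p W = 1"
    and I: "finite I" and f: "f \<in> borel_measurable (Pi\<^sub>M I (\<lambda>_. M))"
  shows "(\<integral>\<^sup>+ z. f z \<partial>Pi\<^sub>M I (\<lambda>_. finite_dist M p W))
    = (\<Sum>z\<in>I \<rightarrow>\<^sub>E W. ennreal (\<Prod>i\<in>I. p (z i)) * f z)"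
  using I f
proof (induction I arbitrary: f)
  case empty
  show ?case by (simp add: PiM_empty nn_integral_count_space_finite)
next
  case (insert i I)
  let ?P = "finite_dist M p W"
  interpret prob_space ?P using W by (rule prob_space_finite_dist)
  interpret product_sigma_finite "\<lambda>_. ?P" by standard
  note insert.prems[measurable]
  have f_P: "f \<in> borel_measurable (Pi\<^sub>M (insert i I) (\<lambda>_. ?P))"
    using insert.prems by (simp cong: measurable_cong_sets sets_PiM_cong)
  have prod: "(\<Prod>j\<in>insert i I. p ((x(i := y)) j)) = p y * (\<Prod>j\<in>I. p (x j))" for x y
    using insert.hyps by (auto intro!: prod.cong)
  have inner: "(\<integral>\<^sup>+ y. f (x(i := y)) \<partial>?P) = (\<Sum>y\<in>W. ennreal (p y) * f (x(i := y)))"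
    if "x \<in> space (Pi\<^sub>M I (\<lambda>_. M))" for x
    using W that by (intro nn_integral_finite_dist) auto
  have space: "space (Pi\<^sub>M I (\<lambda>_. ?P)) = space (Pi\<^sub>M I (\<lambda>_. M))"
    by (intro sets_eq_imp_space_eq sets_PiM_cong) auto
  have [measurable]: "(\<lambda>x. f (x(i := y))) \<in> borel_measurable (Pi\<^sub>M I (\<lambda>_. M))" if "y \<in> W" for y
  proof -
    have [measurable]: "y \<in> space M" using that W(2) by auto
    show ?thesis by measurable
  qed
  have "(\<integral>\<^sup>+ z. f z \<partial>Pi\<^sub>M (insert i I) (\<lambda>_. ?P))
      = (\<integral>\<^sup>+ x. (\<integral>\<^sup>+ y. f (x(i := y)) \<partial>?P) \<partial>Pi\<^sub>M I (\<lambda>_. ?P))"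
    using insert.hyps f_P by (rule product_nn_integral_insert)
  also have "\<dots> = (\<integral>\<^sup>+ x. (\<Sum>y\<in>W. ennreal (p y) * f (x(i := y))) \<partial>Pi\<^sub>M I (\<lambda>_. ?P))"
    by (intro nn_integral_cong inner) (simp add: space)
  also have "\<dots> = (\<Sum>x\<in>I \<rightarrow>\<^sub>E W. ennreal (\<Prod>j\<in>I. p (x j)) * (\<Sum>y\<in>W. ennreal (p y) * f (x(i := y))))"
    by (rule insert.IH) measurable
  also have "\<dots> = (\<Sum>x\<in>I \<rightarrow>\<^sub>E W. \<Sum>y\<in>W. ennreal (\<Prod>j\<in>insert i I. p ((x(i := y)) j)) * f (x(i := y)))"
    unfolding prod sum_distrib_left
    using W(3) by (intro sum.cong refl)
      (auto simp: ennreal_mult' mult_ac intro!: arg_cong2[of _ _ _ _ times] prod_nonneg dest: PiE_mem)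
  also have "\<dots> = (\<Sum>(y, x)\<in>W \<times> (I \<rightarrow>\<^sub>E W). ennreal (\<Prod>j\<in>insert i I. p ((x(i := y)) j)) * f (x(i := y)))"
    by (subst sum.swap) (simp add: sum.cartesian_product)
  also have "\<dots> = (\<Sum>z\<in>insert i I \<rightarrow>\<^sub>E W. ennreal (\<Prod>j\<in>insert i I. p (z j)) * f z)"
    unfolding PiE_insert_eq using inj_combinator[of i I "\<lambda>_. W"] insert.hyps
    by (subst sum.reindex) (auto simp: case_prod_beta comp_def)
  finally show ?case .
qed

section \<open>Assouad's method\<close>

text \<open>Le Cam's inequality between total variation and Hellinger affinity.\<close>
lemma affinity_le_sum_min:
  fixes p p' :: "'a \<Rightarrow> real"
  assumes "\<And>z. z \<in> Z \<Longrightarrow> p z \<ge> 0" "\<And>z. z \<in> Z \<Longrightarrow> p' z \<ge> 0" "sum p Z = 1" "sum p' Z = 1"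
  shows "(\<Sum>z\<in>Z. sqrt (p z * p' z))\<^sup>2 \<le> 2 * (\<Sum>z\<in>Z. min (p z) (p' z))"
proof -
  \<comment> \<open>Written as minimum times maximum, the product is separated by the Cauchy-Schwarz
    inequality; the maxima are at most \<open>p z + p' z\<close> and sum to at most two.\<close>
  have "sqrt (p z * p' z) = sqrt (min (p z) (p' z)) * sqrt (max (p z) (p' z))" for z
    by (simp add: real_sqrt_mult min_def max_def mult_ac)
  hence "(\<Sum>z\<in>Z. sqrt (p z * p' z))\<^sup>2
      \<le> (\<Sum>z\<in>Z. (sqrt (min (p z) (p' z)))\<^sup>2) * (\<Sum>z\<in>Z. (sqrt (max (p z) (p' z)))\<^sup>2)"
    using Cauchy_Schwarz_ineq_sum by simp
  also have "\<dots> = (\<Sum>z\<in>Z. min (p z) (p' z)) * (\<Sum>z\<in>Z. max (p z) (p' z))"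
    using assms by (intro arg_cong2[of _ _ _ _ times] sum.cong refl real_sqrt_pow2) (auto simp: le_max_iff_disj)
  also have "\<dots> \<le> (\<Sum>z\<in>Z. min (p z) (p' z)) * (\<Sum>z\<in>Z. p z + p' z)"
    using assms by (intro mult_left_mono sum_mono sum_nonneg) auto
  also have "\<dots> = 2 * (\<Sum>z\<in>Z. min (p z) (p' z))" using assms by (simp add: sum.distrib)
  finally show ?thesis .
qed

text \<open>The affinity is multiplicative over independent observations. Bernoulli's inequality
  with \<open>2 * n\<close> factors keeps its square above \<open>1 - 2 * n * e \<ge> 1 / 2\<close>,
  and Le Cam's inequality halves this.\<close>

lemma sum_min_product_ge:
  fixes p p' :: "'a \<Rightarrow> real"
  assumes W: "finite W" "\<And>v. v \<in> W \<Longrightarrow> p v \<ge> 0" "\<And>v. v \<in> W \<Longrightarrow> p' v \<ge> 0"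
      "sum p W = 1" "sum p' W = 1"
    and aff: "(\<Sum>v\<in>W. sqrt (p v * p' v)) = 1 - e" and e: "e \<le> 1" "real n * e \<le> 1 / 4"
  shows "1 / 4 \<le> (\<Sum>z\<in>{..<n} \<rightarrow>\<^sub>E W. min (\<Prod>i<n. p (z i)) (\<Prod>i<n. p' (z i)))"
proof -
  let ?Z = "{..<n} \<rightarrow>\<^sub>E W"
  have sum_prod: "(\<Sum>z\<in>?Z. \<Prod>i<n. f (z i)) = (sum f W) ^ n" for f :: "'a \<Rightarrow> real"
    using prod_sum_PiE[of "{..<n}" "\<lambda>_. W" "\<lambda>_. f"] W(1) by simp
  have prod_ge_0: "(\<Prod>i<n. f (z i)) \<ge> 0" if "z \<in> ?Z" "\<And>v. v \<in> W \<Longrightarrow> f v \<ge> 0" for f :: "'a \<Rightarrow> real" and z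
    using that by (auto intro!: prod_nonneg dest: PiE_mem)
  have sqrt_prod: "sqrt (\<Prod>i<n. f i) = (\<Prod>i<n. sqrt (f i))" for f :: "nat \<Rightarrow> real"
    by (induction n) (simp_all add: real_sqrt_mult)
  have "(\<Sum>z\<in>?Z. sqrt ((\<Prod>i<n. p (z i)) * (\<Prod>i<n. p' (z i)))) = (\<Sum>z\<in>?Z. \<Prod>i<n. sqrt (p (z i) * p' (z i)))"
    by (simp add: sqrt_prod flip: prod.distrib)
  also have "\<dots> = (1 - e) ^ n" unfolding aff[symmetric] by (rule sum_prod)
  finally have "((1 - e) ^ n)\<^sup>2 \<le> 2 * (\<Sum>z\<in>?Z. min (\<Prod>i<n. p (z i)) (\<Prod>i<n. p' (z i)))"
    using affinity_le_sum_min[of ?Z "\<lambda>z. \<Prod>i<n. p (z i)" "\<lambda>z. \<Prod>i<n. p' (z i)"]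
      W(4,5) sum_prod[of p] sum_prod[of p'] prod_ge_0[of _ p] prod_ge_0[of _ p'] W(2,3)
    by simp
  moreover have "1 + real (n * 2) * (- e) \<le> (1 + (- e)) ^ (n * 2)"
    using e by (intro Bernoulli_inequality) auto
  ultimately show ?thesis using e by (simp add: power_mult)
qed

abbreviation signs :: "nat \<Rightarrow> (nat \<Rightarrow> real) set" where
  "signs k \<equiv> {..<k} \<rightarrow>\<^sub>E {1, - 1}"

text \<open>Each sign vector is paired with its flip at \<open>j\<close>. On the mass common to
  both, the losses for the two signs add up to at least \<open>D\<close>, so coordinate
  \<open>j\<close> contributes at least \<open>\<tau> * D / 2\<close> on average over the cube, and
  some vertex is no better than the average.\<close>

lemma assouad:
  fixes Q :: "(nat \<Rightarrow> real) \<Rightarrow> 'z \<Rightarrow> real" and L :: "nat \<Rightarrow> real \<Rightarrow> 'z \<Rightarrow> real"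
  assumes L: "\<And>j e z. L j e z \<ge> 0" "\<And>j z. L j 1 z + L j (- 1) z \<ge> D" and D: "D \<ge> 0"
    and min: "\<And>\<sigma> j. \<sigma> \<in> signs k \<Longrightarrow> j < k \<Longrightarrow> \<tau> \<le> (\<Sum>z\<in>Z. min (Q \<sigma> z) (Q (\<sigma>(j := - \<sigma> j)) z))"
    and Q: "\<And>\<sigma> z. \<sigma> \<in> signs k \<Longrightarrow> z \<in> Z \<Longrightarrow> Q \<sigma> z \<ge> 0"
  shows "\<exists>\<sigma>\<in>signs k. real k * \<tau> * D / 2 \<le> (\<Sum>j<k. \<Sum>z\<in>Z. Q \<sigma> z * L j (\<sigma> j) z)"
proof (rule ccontr)
  assume contra: "\<not> ?thesis"
  define F where "F = (\<lambda>j \<sigma>. \<Sum>z\<in>Z. Q \<sigma> z * L j (\<sigma> j) z)"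
  have fin: "finite (signs k)" by (intro finite_PiE) auto
  have nonempty: "signs k \<noteq> {}" by (simp add: PiE_eq_empty_iff)
  have flip: "\<sigma>(j := - \<sigma> j) \<in> signs k" if "\<sigma> \<in> signs k" "j < k" for \<sigma> j
    using that by (auto simp: PiE_iff extensional_def)
  have pair: "\<tau> * D \<le> F j \<sigma> + F j (\<sigma>(j := - \<sigma> j))" if "\<sigma> \<in> signs k" "j < k" for \<sigma> j
  proof -
    let ?m = "\<lambda>z. min (Q \<sigma> z) (Q (\<sigma>(j := - \<sigma> j)) z)"
    have "\<sigma> j \<in> {1, - 1}" using that by (auto dest: PiE_mem)
    hence L2: "D \<le> L j (\<sigma> j) z + L j (- \<sigma> j) z" for z
      using L(2)[of j z] by auto
    have "\<tau> * D \<le> (\<Sum>z\<in>Z. ?m z) * D" using min[OF that] D by (rule mult_right_mono)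
    also have "\<dots> \<le> (\<Sum>z\<in>Z. ?m z * (L j (\<sigma> j) z + L j (- \<sigma> j) z))"
      unfolding sum_distrib_right using Q flip that L2 by (intro sum_mono mult_left_mono) auto
    also have "\<dots> \<le> (\<Sum>z\<in>Z. Q \<sigma> z * L j (\<sigma> j) z + Q (\<sigma>(j := - \<sigma> j)) z * L j (- \<sigma> j) z)"
      unfolding distrib_left using L(1) by (intro sum_mono add_mono mult_right_mono) auto
    also have "\<dots> = F j \<sigma> + F j (\<sigma>(j := - \<sigma> j))" by (simp add: F_def sum.distrib)
    finally show ?thesis .
  qed
  have "real (card (signs k)) * (\<tau> * D) \<le> 2 * (\<Sum>\<sigma>\<in>signs k. F j \<sigma>)" if "j < k" for j
  proof -
    \<comment> \<open>Flipping coordinate \<open>j\<close> is an involution of the cube.\<close>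
    have "(\<Sum>\<sigma>\<in>signs k. F j (\<sigma>(j := - \<sigma> j))) = (\<Sum>\<sigma>\<in>signs k. F j \<sigma>)"
      by (rule sum.reindex_bij_witness[where i = "\<lambda>\<sigma>. \<sigma>(j := - \<sigma> j)" and j = "\<lambda>\<sigma>. \<sigma>(j := - \<sigma> j)"])
        (use flip that in auto)
    moreover have "(\<Sum>\<sigma>\<in>signs k. \<tau> * D) \<le> (\<Sum>\<sigma>\<in>signs k. F j \<sigma> + F j (\<sigma>(j := - \<sigma> j)))"
      using pair that by (intro sum_mono) auto
    ultimately show ?thesis by (simp add: sum.distrib)
  qed
  hence "(\<Sum>j<k. real (card (signs k)) * (\<tau> * D)) \<le> (\<Sum>j<k. 2 * (\<Sum>\<sigma>\<in>signs k. F j \<sigma>))"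
    by (intro sum_mono) auto
  also have "\<dots> = 2 * (\<Sum>\<sigma>\<in>signs k. \<Sum>j<k. F j \<sigma>)"
    by (subst sum.swap) (simp add: sum_distrib_left)
  also have "\<dots> < 2 * (\<Sum>\<sigma>\<in>signs k. real k * \<tau> * D / 2)"
    using contra unfolding F_def
    by (intro mult_strict_left_mono sum_strict_mono[OF fin nonempty]) (auto simp: not_le)
  also have "\<dots> = (\<Sum>j<k. real (card (signs k)) * (\<tau> * D))" by simp
  finally show False by simp
qed

section \<open>Convexity of the loss\<close>

lemma powr_tangent_nonneg:
  fixes u v q :: real
  assumes "q > 1" "u \<ge> 0" "v \<ge> 0"
  shows "v powr q + q * v powr (q - 1) * (u - v) \<le> u powr q"
proof (cases "v = 0")
  case False
  \<comment> \<open>Young's inequality with the conjugate exponents \<open>q\<close> and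
    \<open>q / (q - 1)\<close> is the tangent inequality in disguise.\<close>
  have "u * v powr (q - 1) \<le> u powr q / q + (v powr (q - 1)) powr (q / (q - 1)) / (q / (q - 1))"
    using assms by (intro Youngs_inequality) (auto simp: field_simps)
  also have "(v powr (q - 1)) powr (q / (q - 1)) = v powr q" using assms by (simp add: powr_powr)
  finally have "q * (u * v powr (q - 1)) \<le> u powr q + (q - 1) * v powr q"
    using assms by (simp add: field_simps)
  moreover have "v powr (q - 1) * v = v powr q"
    using assms False powr_mult_base[of v "q - 1"] by (simp add: mult.commute)
  ultimately show ?thesis by (simp add: algebra_simps)
qed (use assms in auto)

text \<open>A subgradient inequality: \<open>\<bar>y - a\<bar>\<close> exceeds
  \<open>\<bar>y - h\<bar>\<close> by at least \<open>sgn (y - h) * (h - a)\<close>, and the tangent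
  of the power at \<open>\<bar>y - h\<bar>\<close> has nonnegative slope.\<close>

lemma powr_loss_tangent:
  fixes y a h q :: real
  assumes "q > 1"
  shows "\<bar>y - h\<bar> powr q - q * sgn (y - h) * \<bar>y - h\<bar> powr (q - 1) * (a - h) \<le> \<bar>y - a\<bar> powr q"
proof -
  let ?v = "\<bar>y - h\<bar>"
  have "sgn (y - h) * (h - a) \<le> \<bar>y - a\<bar> - ?v"
    by (auto simp: sgn_if abs_if)
  hence "q * ?v powr (q - 1) * (sgn (y - h) * (h - a)) \<le> q * ?v powr (q - 1) * (\<bar>y - a\<bar> - ?v)"
    using assms by (intro mult_left_mono) auto
  with powr_tangent_nonneg[OF assms, of "\<bar>y - a\<bar>" ?v] show ?thesis by (simp add: algebra_simps)
qed

text \<open>The last assumption is the first-order condition at \<open>h\<close>: it cancels the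
  linear part of the tangents averaged over \<open>mu\<close>.\<close>

lemma powr_loss_minimal:
  fixes mu :: "real \<Rightarrow> real"
  assumes "q > 1" "\<And>y. y \<in> V \<Longrightarrow> mu y \<ge> 0"
    and "(\<Sum>y\<in>V. mu y * (sgn (y - h) * \<bar>y - h\<bar> powr (q - 1))) = 0"
  shows "(\<Sum>y\<in>V. mu y * \<bar>y - h\<bar> powr q) \<le> (\<Sum>y\<in>V. mu y * \<bar>y - a\<bar> powr q)"
proof -
  have "(\<Sum>y\<in>V. mu y * \<bar>y - h\<bar> powr q) = (\<Sum>y\<in>V. mu y * \<bar>y - h\<bar> powr q)
      - q * (a - h) * (\<Sum>y\<in>V. mu y * (sgn (y - h) * \<bar>y - h\<bar> powr (q - 1)))"
    using assms(3) by simp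
  also have "\<dots> = (\<Sum>y\<in>V. mu y * (\<bar>y - h\<bar> powr q - q * sgn (y - h) * \<bar>y - h\<bar> powr (q - 1) * (a - h)))"
    by (simp add: sum_distrib_left algebra_simps flip: sum_subtractf)
  also have "\<dots> \<le> (\<Sum>y\<in>V. mu y * \<bar>y - a\<bar> powr q)"
    using assms(2) powr_loss_tangent[OF assms(1)] by (intro sum_mono mult_left_mono) auto
  finally show ?thesis .
qed

section \<open>The cube of distributions\<close>

text \<open>Symmetry of \<open>V\<close> lets it carry the reflected law as well; \<open>0\<close>
  is the output at the uninformative input. By \<open>opt\<close>, \<open>h\<close> is a best
  constant prediction.\<close>

locale output_law =
  fixes q h :: real and V :: "real set" and mu :: "real \<Rightarrow> real"
  assumes q: "q > 1"
    and V: "finite V" "uminus ` V = V" "0 \<in> V"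
    and mu: "\<And>y. y \<in> V \<Longrightarrow> mu y \<ge> 0" "sum mu V = 1"
    and opt: "\<And>a. (\<Sum>y\<in>V. mu y * \<bar>y - h\<bar> powr q) \<le> (\<Sum>y\<in>V. mu y * \<bar>y - a\<bar> powr q)"
begin

definition mean_loss :: "real \<Rightarrow> real" where
  "mean_loss a = (\<Sum>y\<in>V. mu y * \<bar>y - a\<bar> powr q)"

text \<open>The Hellinger affinity of \<open>mu\<close> and its reflection.\<close>

definition affinity :: real where
  "affinity = (\<Sum>y\<in>V. sqrt (mu y * mu (- y)))"

end

text \<open>The cube has \<open>k\<close> points of mass \<open>w / k\<close>, at which the output law is \<open>mu\<close> or its
  reflection, depending on the sign vector; the output is \<open>0\<close> at a further point of mass \<open>1 - w\<close>.\<close>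
locale sign_cube = output_law +
  fixes w :: real and k :: nat
  assumes w: "0 \<le> w" "w \<le> 1" and k: "k \<ge> 1"
begin

definition mass :: "(nat \<Rightarrow> real) \<Rightarrow> nat \<times> real \<Rightarrow> real" where
  "mass \<sigma> = (\<lambda>(x, y). if x < k then w / real k * mu (\<sigma> x * y) else if y = 0 then 1 - w else 0)"

text \<open>A pointwise best prediction under \<open>law \<sigma>\<close>; at the uninformative
  input \<open>k\<close> the output is \<open>0\<close>.\<close>

definition cube_point :: "(nat \<Rightarrow> real) \<Rightarrow> nat \<Rightarrow> real" where
  "cube_point \<sigma> = (\<lambda>x\<in>{..k}. if x < k then \<sigma> x * h else 0)"

abbreviation "inputs \<equiv> count_space {..k}"
abbreviation "data \<equiv> {..k} \<times> V"
abbreviation "law \<sigma> \<equiv> finite_dist (inputs \<Otimes>\<^sub>M borel) (mass \<sigma>) data"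

lemma sum_V_sign: "(\<Sum>y\<in>V. f (e * y)) = sum f V" if "e \<in> {1, - 1}" for f :: "real \<Rightarrow> real"
proof (cases "e = 1")
  case False
  hence "(\<Sum>y\<in>V. f (e * y)) = (\<Sum>y\<in>V. f (- y))" using that by simp
  also have "\<dots> = sum f (uminus ` V)" by (subst sum.reindex) (auto simp: inj_on_def)
  finally show ?thesis by (simp add: V)
qed simp

lemma V_sign: "e * y \<in> V" if "y \<in> V" "e \<in> {1, - 1}" for e y
  using that V(2) by auto

lemma sign_mem: "\<sigma> x \<in> {1, - 1}" if "\<sigma> \<in> signs k" "x < k"
  using that by (auto dest: PiE_mem)

text \<open>The tangents at prediction \<open>0\<close> towards \<open>a\<close> and
  \<open>- a\<close> have opposite linear parts. Thus \<open>0\<close> is the best compromise when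
  the sign is unknown.\<close>

lemma mean_loss_midpoint: "2 * mean_loss 0 \<le> mean_loss a + mean_loss (- a)"
proof -
  have "2 * \<bar>y\<bar> powr q \<le> \<bar>y - a\<bar> powr q + \<bar>y - - a\<bar> powr q" for y
    using powr_loss_tangent[OF q, of y 0 a] powr_loss_tangent[OF q, of y 0 "- a"] by simp
  hence "(\<Sum>y\<in>V. mu y * (2 * \<bar>y\<bar> powr q)) \<le> (\<Sum>y\<in>V. mu y * (\<bar>y - a\<bar> powr q + \<bar>y - - a\<bar> powr q))"
    using mu by (intro sum_mono mult_left_mono) auto
  thus ?thesis
    by (simp add: mean_loss_def sum.distrib sum_distrib_left distrib_left mult_ac)
qed

lemma mean_loss_nonneg: "mean_loss a \<ge> 0"
  unfolding mean_loss_def using mu by (intro sum_nonneg) auto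

lemma mean_loss_opt: "mean_loss h \<le> mean_loss a"
  unfolding mean_loss_def by (rule opt)

lemma sum_split_last: "(\<Sum>v\<in>data. f v) = (\<Sum>x<k. \<Sum>y\<in>V. f (x, y)) + (\<Sum>y\<in>V. f (k, y))"
  for f :: "nat \<times> real \<Rightarrow> real"
  by (simp add: sum.cartesian_product' lessThan_Suc_atMost[symmetric])

lemma sum_mass:
  assumes "\<sigma> \<in> signs k"
  shows "(\<Sum>(x, y)\<in>data. mass \<sigma> (x, y) * f x y)
    = (\<Sum>x<k. w / real k * (\<Sum>y\<in>V. mu y * f x (\<sigma> x * y))) + (1 - w) * f k 0"
proof -
  have "(\<Sum>y\<in>V. mass \<sigma> (x, y) * f x y) = w / real k * (\<Sum>y\<in>V. mu y * f x (\<sigma> x * y))" if "x < k" for x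
  proof -
    have e: "\<sigma> x \<in> {1, - 1}" using sign_mem[OF assms that] .
    \<comment> \<open>Signs square to one, so the summand depends on \<open>y\<close> only through
      \<open>\<sigma> x * y\<close>, and reindexing moves the sign from \<open>mu\<close> to
      \<open>f\<close>.\<close>
    have "(\<Sum>y\<in>V. mass \<sigma> (x, y) * f x y) = (\<Sum>y\<in>V. w / real k * (mu (\<sigma> x * y) * f x (\<sigma> x * (\<sigma> x * y))))"
      using that e by (auto simp: mass_def intro!: sum.cong)
    also have "\<dots> = w / real k * (\<Sum>y\<in>V. mu (\<sigma> x * y) * f x (\<sigma> x * (\<sigma> x * y)))"
      by (simp add: sum_distrib_left)
    also have "\<dots> = w / real k * (\<Sum>y\<in>V. mu y * f x (\<sigma> x * y))"
      using sum_V_sign[OF e, of "\<lambda>y. mu y * f x (\<sigma> x * y)"] by simp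
    finally show ?thesis .
  qed
  moreover have "(\<Sum>y\<in>V. mass \<sigma> (k, y) * f k y) = (\<Sum>y\<in>V. if y = 0 then (1 - w) * f k 0 else 0)"
    by (intro sum.cong) (auto simp: mass_def)
  ultimately show ?thesis using V by (simp add: sum_split_last sum.delta)
qed

lemma mass_nonneg: "\<sigma> \<in> signs k \<Longrightarrow> v \<in> data \<Longrightarrow> mass \<sigma> v \<ge> 0"
  using w mu V_sign sign_mem by (auto simp: mass_def split: prod.splits)

lemma sum_mass_1: "\<sigma> \<in> signs k \<Longrightarrow> sum (mass \<sigma>) data = 1"
  using sum_mass[of \<sigma> "\<lambda>_ _. 1"] mu k by (simp add: case_prod_beta)

lemma data_subset: "finite data" "data \<subseteq> space (inputs \<Otimes>\<^sub>M borel)"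
  using V by (auto simp: space_pair_measure)

lemma law_data_distribution: "\<sigma> \<in> signs k \<Longrightarrow> law \<sigma> \<in> data_distributions inputs"
  unfolding data_distributions_def
  using prob_space_finite_dist[OF data_subset mass_nonneg sum_mass_1] by auto

lemma nn_integral_law:
  assumes \<sigma>: "\<sigma> \<in> signs k" and f: "\<And>x y. f x y \<ge> 0"
    and [measurable]: "case_prod f \<in> borel_measurable (inputs \<Otimes>\<^sub>M borel)"
  shows "(\<integral>\<^sup>+ (x, y). ennreal (f x y) \<partial>law \<sigma>)
    = ennreal ((\<Sum>x<k. w / real k * (\<Sum>y\<in>V. mu y * f x (\<sigma> x * y))) + (1 - w) * f k 0)"
proof -
  have "(\<integral>\<^sup>+ v. ennreal (case_prod f v) \<partial>law \<sigma>) = (\<Sum>v\<in>data. ennreal (mass \<sigma> v) * ennreal (case_prod f v))"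
    by (intro nn_integral_finite_dist data_subset) measurable
  also have "\<dots> = (\<Sum>v\<in>data. ennreal (mass \<sigma> v * case_prod f v))"
    using mass_nonneg[OF \<sigma>] f by (intro sum.cong refl) (auto simp: ennreal_mult)
  also have "\<dots> = ennreal (\<Sum>v\<in>data. mass \<sigma> v * case_prod f v)"
    using mass_nonneg[OF \<sigma>] f by (intro sum_ennreal) (auto simp: case_prod_beta)
  also have "(\<Sum>v\<in>data. mass \<sigma> v * case_prod f v)
      = (\<Sum>x<k. w / real k * (\<Sum>y\<in>V. mu y * f x (\<sigma> x * y))) + (1 - w) * f k 0"
    using sum_mass[OF \<sigma>, of f] by (simp add: case_prod_beta)
  also have "(\<lambda>v. ennreal (case_prod f v)) = (\<lambda>(x, y). ennreal (f x y))" by auto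
  finally show ?thesis .
qed

text \<open>Reflecting the output has the same effect on distances as reflecting the prediction, so
  one function \<open>mean_loss\<close> serves all vertices.\<close>

lemma risk_law:
  assumes \<sigma>: "\<sigma> \<in> signs k"
  shows "risk q (law \<sigma>) g
    = ennreal ((\<Sum>x<k. w / real k * mean_loss (\<sigma> x * g x)) + (1 - w) * \<bar>g k\<bar> powr q)"
proof -
  have loss: "\<bar>\<sigma> x * y - g x\<bar> = \<bar>y - \<sigma> x * g x\<bar>" if "x < k" for x y
    using sign_mem[OF \<sigma> that] by auto
  have [measurable]: "g \<in> borel_measurable inputs" by simp
  have "risk q (law \<sigma>) g = ennreal ((\<Sum>x<k. w / real k * (\<Sum>y\<in>V. mu y * \<bar>\<sigma> x * y - g x\<bar> powr q))
      + (1 - w) * \<bar>0 - g k\<bar> powr q)"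
    unfolding risk_def using \<sigma> by (intro nn_integral_law) auto
  thus ?thesis by (simp add: mean_loss_def loss)
qed

lemma output_moment_law:
  assumes \<sigma>: "\<sigma> \<in> signs k"
  shows "output_moment s (law \<sigma>) = ennreal (w * (\<Sum>y\<in>V. mu y * \<bar>y\<bar> powr s))"
proof -
  have "\<bar>\<sigma> x * y\<bar> = \<bar>y\<bar>" if "x < k" for x y using sign_mem[OF \<sigma> that] by auto
  thus ?thesis unfolding output_moment_def
    using k by (subst nn_integral_law[OF \<sigma>]) auto
qed

lemma risk_cube_point:
  assumes \<sigma>: "\<sigma> \<in> signs k"
  shows "risk q (law \<sigma>) (cube_point \<sigma>) = ennreal (w * mean_loss h)"
proof -
  have "mean_loss (\<sigma> x * (\<sigma> x * h)) = mean_loss h" if "x < k" for x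
    using sign_mem[OF \<sigma> that] by auto
  thus ?thesis using k by (simp add: risk_law[OF \<sigma>] cube_point_def)
qed

text \<open>A flip at \<open>j\<close> alters the law only at the input \<open>j\<close>, of mass
  \<open>w / real k\<close>; everything else contributes its full mass.\<close>

lemma affinity_law:
  assumes \<sigma>: "\<sigma> \<in> signs k" and j: "j < k"
  shows "(\<Sum>v\<in>data. sqrt (mass \<sigma> v * mass (\<sigma>(j := - \<sigma> j)) v)) = 1 - w / real k * (1 - affinity)"
proof -
  have wk: "w / real k \<ge> 0" using w by simp
  have "(\<Sum>y\<in>V. sqrt (mass \<sigma> (x, y) * mass (\<sigma>(j := - \<sigma> j)) (x, y)))
      = w / real k * (if x = j then affinity else 1)" if "x < k" for x
  proof -
    have e: "\<sigma> x \<in> {1, - 1}" using sign_mem[OF \<sigma> that] .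
    have "(\<Sum>y\<in>V. sqrt (mass \<sigma> (x, y) * mass (\<sigma>(j := - \<sigma> j)) (x, y)))
        = (\<Sum>y\<in>V. w / real k * sqrt (mu (\<sigma> x * y) * mu (if x = j then - (\<sigma> x * y) else \<sigma> x * y)))"
    proof (rule sum.cong)
      fix y
      have "mass \<sigma> (x, y) * mass (\<sigma>(j := - \<sigma> j)) (x, y)
        = (w / real k)\<^sup>2 * (mu (\<sigma> x * y) * mu (if x = j then - (\<sigma> x * y) else \<sigma> x * y))"
        using that by (simp add: mass_def power2_eq_square)
      thus "sqrt (mass \<sigma> (x, y) * mass (\<sigma>(j := - \<sigma> j)) (x, y))
        = w / real k * sqrt (mu (\<sigma> x * y) * mu (if x = j then - (\<sigma> x * y) else \<sigma> x * y))"
        using wk by (simp only: real_sqrt_mult real_sqrt_abs abs_of_nonneg)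
    qed simp
    also have "\<dots> = w / real k * (\<Sum>y\<in>V. sqrt (mu y * mu (if x = j then - y else y)))"
      unfolding sum_distrib_left[symmetric]
      using sum_V_sign[OF e, of "\<lambda>y. sqrt (mu y * mu (if x = j then - y else y))"] by simp
    also have "(\<Sum>y\<in>V. sqrt (mu y * mu (if x = j then - y else y))) = (if x = j then affinity else 1)"
      using mu by (auto simp: affinity_def)
    finally show ?thesis .
  qed
  moreover have "(\<Sum>y\<in>V. sqrt (mass \<sigma> (k, y) * mass (\<sigma>(j := - \<sigma> j)) (k, y)))
      = (\<Sum>y\<in>V. if y = 0 then 1 - w else 0)"
    using w by (intro sum.cong) (auto simp: mass_def)
  ultimately have "(\<Sum>v\<in>data. sqrt (mass \<sigma> v * mass (\<sigma>(j := - \<sigma> j)) v))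
      = w / real k * (\<Sum>x<k. if x = j then affinity else 1) + (1 - w)"
    using V by (simp add: sum_split_last sum_distrib_left)
  also have "(\<Sum>x<k. if x = j then affinity else 1) = real k - 1 + affinity"
    using j by (subst sum.remove[of _ j]) (auto simp: of_nat_diff)
  also have "w / real k * (real k - 1 + affinity) + (1 - w) = 1 - w / real k * (1 - affinity)"
    using k by (simp add: field_simps)
  finally show ?thesis .
qed

lemma expected_risk_law:
  assumes \<sigma>: "\<sigma> \<in> signs k" and ghat: "ghat \<in> estimators inputs n"
  shows "expected_risk q n (law \<sigma>) ghat
    = ennreal (\<Sum>z\<in>{..<n} \<rightarrow>\<^sub>E data. (\<Prod>i<n. mass \<sigma> (z i)) *
        ((\<Sum>x<k. w / real k * mean_loss (\<sigma> x * ghat z x)) + (1 - w) * \<bar>ghat z k\<bar> powr q))"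
  (is "_ = ennreal (\<Sum>z\<in>_. ?Q z * ?R z)")
proof -
  have R: "?R z \<ge> 0" for z
    using w mean_loss_nonneg by (intro add_nonneg_nonneg sum_nonneg mult_nonneg_nonneg) auto
  have Q: "?Q z \<ge> 0" if "z \<in> {..<n} \<rightarrow>\<^sub>E data" for z
    using mass_nonneg[OF \<sigma>] that by (intro prod_nonneg) (auto dest: PiE_mem)
  have "expected_risk q n (law \<sigma>) ghat
      = (\<Sum>z\<in>{..<n} \<rightarrow>\<^sub>E data. ennreal (?Q z) * risk q (law \<sigma>) (ghat z))"
    unfolding expected_risk_def sample_dist_def
    using data_subset mass_nonneg[OF \<sigma>] sum_mass_1[OF \<sigma>]
      risk_estimator_measurable[OF ghat law_data_distribution[OF \<sigma>]]
    by (intro nn_integral_PiM_finite_dist) auto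
  also have "\<dots> = (\<Sum>z\<in>{..<n} \<rightarrow>\<^sub>E data. ennreal (?Q z * ?R z))"
    using Q R by (intro sum.cong refl) (auto simp: risk_law[OF \<sigma>] ennreal_mult)
  also have "\<dots> = ennreal (\<Sum>z\<in>{..<n} \<rightarrow>\<^sub>E data. ?Q z * ?R z)"
    using Q R by (intro sum_ennreal) auto
  finally show ?thesis .
qed

text \<open>Assouad's bound with \<open>\<tau> = 1 / 4\<close> and the excess mean loss at input
  \<open>j\<close>, weighted by \<open>w / real k\<close>, as \<open>L\<close>. The factor
  \<open>2\<close> in \<open>D\<close> comes from \<open>mean_loss_midpoint\<close>.\<close>

lemma excess_lower_bound:
  assumes n: "n \<ge> 1" "real n * (w * (1 - affinity)) \<le> real k / 4"
    and ghat: "ghat \<in> estimators inputs n"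
  obtains \<sigma> E where "\<sigma> \<in> signs k" "expected_risk q n (law \<sigma>) ghat = ennreal E"
    "w * (mean_loss 0 - mean_loss h) / 4 \<le> E - w * mean_loss h"
proof -
  let ?Z = "{..<n} \<rightarrow>\<^sub>E data"
  define Q where "Q \<sigma> z = (\<Prod>i<n. mass \<sigma> (z i))" for \<sigma> and z :: "nat \<Rightarrow> nat \<times> real"
  define L where "L j e z = w / real k * (mean_loss (e * ghat z j) - mean_loss h)" for j e z
  define D where "D = 2 * (w / real k * (mean_loss 0 - mean_loss h))"
  have wk: "w / real k \<ge> 0" using w by simp
  have Q_nonneg: "Q \<sigma> z \<ge> 0" if "\<sigma> \<in> signs k" "z \<in> ?Z" for \<sigma> z
    unfolding Q_def using mass_nonneg[OF that(1)] that(2) by (intro prod_nonneg) (auto dest: PiE_mem)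
  have small: "real n * (w / real k * (1 - affinity)) \<le> 1 / 4"
    using n k by (simp add: field_simps)
  have flip: "\<sigma>(j := - \<sigma> j) \<in> signs k" if "\<sigma> \<in> signs k" "j < k" for \<sigma> j
    using that by (auto simp: PiE_iff extensional_def)
  \<comment> \<open>Bernoulli's inequality, used in \<open>sum_min_product_ge\<close>, is restricted
    to a defect of at most one.\<close>
  have le_1: "w / real k * (1 - affinity) \<le> 1"
  proof (cases "w / real k * (1 - affinity) \<le> 0")
    case False
    hence "1 * (w / real k * (1 - affinity)) \<le> real n * (w / real k * (1 - affinity))"
      using n by (intro mult_right_mono) auto
    thus ?thesis using small by linarith
  qed simp
  have "\<exists>\<sigma>\<in>signs k. real k * (1 / 4) * D / 2 \<le> (\<Sum>j<k. \<Sum>z\<in>?Z. Q \<sigma> z * L j (\<sigma> j) z)"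
  proof (rule assouad)
    show "L j e z \<ge> 0" for j e z unfolding L_def using wk mean_loss_opt by (intro mult_nonneg_nonneg) auto
    show "L j 1 z + L j (- 1) z \<ge> D" for j z
      using mult_left_mono[OF mean_loss_midpoint[of "ghat z j"] wk]
      by (simp add: L_def D_def algebra_simps)
    show "D \<ge> 0" unfolding D_def using wk mean_loss_opt by (intro mult_nonneg_nonneg) auto
    show "Q \<sigma> z \<ge> 0" if "\<sigma> \<in> signs k" "z \<in> ?Z" for \<sigma> z using Q_nonneg that .
    show "1 / 4 \<le> (\<Sum>z\<in>?Z. min (Q \<sigma> z) (Q (\<sigma>(j := - \<sigma> j)) z))" if "\<sigma> \<in> signs k" "j < k" for \<sigma> j
      unfolding Q_def
      by (rule sum_min_product_ge[OF data_subset(1) mass_nonneg[OF that(1)] mass_nonneg[OF flip[OF that]]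
            sum_mass_1[OF that(1)] sum_mass_1[OF flip[OF that]] affinity_law[OF that] le_1 small])
  qed
  then obtain \<sigma> where \<sigma>: "\<sigma> \<in> signs k"
      and le: "real k * (1 / 4) * D / 2 \<le> (\<Sum>j<k. \<Sum>z\<in>?Z. Q \<sigma> z * L j (\<sigma> j) z)" by blast
  define E where "E = (\<Sum>z\<in>?Z. Q \<sigma> z *
    ((\<Sum>x<k. w / real k * mean_loss (\<sigma> x * ghat z x)) + (1 - w) * \<bar>ghat z k\<bar> powr q))"
  have sum_Q: "(\<Sum>z\<in>?Z. Q \<sigma> z) = 1"
    using prod_sum_PiE[of "{..<n}" "\<lambda>_. data" "\<lambda>_. mass \<sigma>"] data_subset sum_mass_1[OF \<sigma>] by (simp add: Q_def)
  have "w * (mean_loss 0 - mean_loss h) / 4 = real k * (1 / 4) * D / 2"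
    using k by (simp add: D_def)
  also note le
  also have "(\<Sum>j<k. \<Sum>z\<in>?Z. Q \<sigma> z * L j (\<sigma> j) z) = (\<Sum>z\<in>?Z. Q \<sigma> z * (\<Sum>j<k. L j (\<sigma> j) z))"
    by (subst sum.swap) (simp add: sum_distrib_left)
  also have "\<dots> = (\<Sum>z\<in>?Z. Q \<sigma> z * ((\<Sum>x<k. w / real k * mean_loss (\<sigma> x * ghat z x)) - w * mean_loss h))"
    using k by (simp add: L_def right_diff_distrib sum_subtractf)
  \<comment> \<open>The nonnegative loss at the uninformative input completes the risk.\<close>
  also have "\<dots> \<le> (\<Sum>z\<in>?Z. Q \<sigma> z *
      ((\<Sum>x<k. w / real k * mean_loss (\<sigma> x * ghat z x)) + (1 - w) * \<bar>ghat z k\<bar> powr q - w * mean_loss h))"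
    using w Q_nonneg[OF \<sigma>] by (intro sum_mono mult_left_mono) auto
  also have "\<dots> = E - w * mean_loss h"
    using sum_Q by (simp add: E_def right_diff_distrib sum_subtractf flip: sum_distrib_right)
  finally have "w * (mean_loss 0 - mean_loss h) / 4 \<le> E - w * mean_loss h" .
  thus thesis using that[OF \<sigma> _] expected_risk_law[OF \<sigma> ghat] unfolding E_def Q_def by blast
qed

lemma cube_point_props:
  assumes "\<sigma> \<in> signs k" "0 < h" "h \<le> b"
  shows "cube_point \<sigma> \<in> prediction_functions inputs" "\<forall>x\<le>k. \<bar>cube_point \<sigma> x\<bar> \<le> b"
  using sign_mem[OF assms(1)] assms(2,3)
  by (force simp: prediction_functions_def cube_point_def)+

lemma inj_on_cube_point:
  assumes "h \<noteq> 0" shows "inj_on cube_point (signs k)"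
proof (rule inj_onI)
  fix \<sigma> \<sigma>' assume *: "\<sigma> \<in> signs k" "\<sigma>' \<in> signs k" "cube_point \<sigma> = cube_point \<sigma>'"
  show "\<sigma> = \<sigma>'"
  proof (rule PiE_ext[OF *(1,2)])
    fix x assume "x \<in> {..<k}"
    thus "\<sigma> x = \<sigma>' x" using fun_cong[OF *(3), of x] assms by (simp add: cube_point_def)
  qed
qed

text \<open>The cube points are padded with other bounded functions to exactly \<open>d\<close>
  members; enlarging \<open>G\<close> can only lower the subtracted minimum.\<close>

lemma lower_bound_holds_cube:
  assumes h: "0 < h" "h \<le> b" and n: "n \<ge> 1" and d: "2 ^ k \<le> d"
    and close: "real n * (w * (1 - affinity)) \<le> real k / 4"
    and moment: "w * (\<Sum>y\<in>V. mu y * \<bar>y\<bar> powr s) \<le> A"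
    and rate: "C * min (ln (real d) / real n) 1 powr (1 - (q - 1) / s) \<le> w * (mean_loss 0 - mean_loss h) / 4"
      "C * min (ln (real d) / real n) 1 powr (1 - q / (s + 2)) \<le> w * (mean_loss 0 - mean_loss h) / 4"
  shows "lower_bound_holds C b A q s d n inputs"
proof -
  let ?F = "{f \<in> prediction_functions inputs. \<forall>x\<le>k. \<bar>f x\<bar> \<le> b}"
  let ?H = "cube_point ` signs k"
  have "finite (signs k)" by (intro finite_PiE) auto
  hence H: "finite ?H" "card ?H = 2 ^ k"
    using h inj_on_cube_point by (auto simp: card_image card_PiE numeral_2_eq_2)
  \<comment> \<open>Constants in \<open>{0..b}\<close>, told apart at the input \<open>0\<close>,
    show that there are enough functions for the padding.\<close>
  have "inj_on (\<lambda>c. \<lambda>x\<in>{..k}. c) {0..b}"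
    by (rule inj_onI) (auto dest: fun_cong[where x = 0])
  moreover have "infinite {0..b}" using h by (simp add: infinite_Icc_iff)
  ultimately have "infinite ((\<lambda>c. \<lambda>x\<in>{..k}. c) ` {0..b})" by (simp only: finite_image_iff not_False_eq_True)
  moreover have "(\<lambda>c. \<lambda>x\<in>{..k}. c) ` {0..b} \<subseteq> ?F" by (auto simp: prediction_functions_def)
  ultimately have "infinite ?F" by (rule infinite_super[rotated])
  hence "infinite (?F - ?H)" using H by simp
  then obtain K where K: "finite K" "card K = d - 2 ^ k" "K \<subseteq> ?F - ?H"
    using infinite_arbitrarily_large by blast
  define G where "G = ?H \<union> K"
  have "?H \<inter> K = {}" using K(3) by blast
  hence "card G = card ?H + card K" unfolding G_def by (intro card_Un_disjoint H(1) K(1))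
  hence G: "finite G" "card G = d" "?H \<subseteq> G"
    using H K(1,2) d by (simp_all add: G_def)
  have GF: "G \<subseteq> ?F"
    using K(3) cube_point_props[OF _ h] unfolding G_def by blast
  show ?thesis unfolding lower_bound_holds_def
  proof (intro exI[of _ G] conjI ballI)
    fix ghat assume ghat: "ghat \<in> estimators inputs n"
    obtain \<sigma> E where \<sigma>: "\<sigma> \<in> signs k" and E: "expected_risk q n (law \<sigma>) ghat = ennreal E"
      and low: "w * (mean_loss 0 - mean_loss h) / 4 \<le> E - w * mean_loss h"
      using excess_lower_bound[OF n close ghat] by blast
    have "Min (risk q (law \<sigma>) ` G) \<le> ennreal (w * mean_loss h)"
      using G \<sigma> risk_cube_point[OF \<sigma>] by (metis Min_le finite_imageI image_eqI subsetD)
    hence "enn2ereal (Min (risk q (law \<sigma>) ` G)) \<le> ereal (w * mean_loss h)"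
      using w mean_loss_nonneg by (metis enn2ereal_ennreal less_eq_ennreal.rep_eq mult_nonneg_nonneg)
    \<comment> \<open>Since \<open>ennreal\<close> truncates at zero,
      \<open>enn2ereal (ennreal E)\<close> is \<open>E\<close> only for nonnegative
      \<open>E\<close>.\<close>
    moreover have "E \<ge> 0"
    proof -
      have "0 \<le> w * (mean_loss 0 - mean_loss h)" "0 \<le> w * mean_loss h"
        using w mean_loss_nonneg mean_loss_opt by simp_all
      with low show ?thesis by linarith
    qed
    ultimately have "ereal (E - w * mean_loss h) \<le> excess_risk q n (law \<sigma>) G ghat"
      unfolding excess_risk_def E by (simp add: enn2ereal_ennreal ereal_minus_mono flip: ereal_minus(1))
    moreover have "ereal x \<le> ereal (E - w * mean_loss h)" if "x \<le> w * (mean_loss 0 - mean_loss h) / 4" for x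
      using that low by simp
    moreover have "output_moment s (law \<sigma>) \<le> ennreal A"
      using moment by (simp add: output_moment_law[OF \<sigma>] ennreal_leI)
    ultimately show "\<exists>P\<in>data_distributions inputs. output_moment s P \<le> ennreal A \<and>
      ereal (C * min (ln (real (card G)) / real n) 1 powr (1 - (q - 1) / s)) \<le> excess_risk q n P G ghat \<and>
      ereal (C * min (ln (real (card G)) / real n) 1 powr (1 - q / (s + 2))) \<le> excess_risk q n P G ghat"
      using law_data_distribution[OF \<sigma>] rate unfolding G(2) by (meson order_trans)
  qed (use G GF in auto)
qed

end

section \<open>Two families of output laws\<close>

text \<open>The demands of the cube on an output law at level \<open>t\<close>, with
  \<open>r\<close> the guaranteed loss. The bound \<open>t / 8\<close> suffices for
  indistinguishability because \<open>n * t \<le> ln d \<le> 2 * k\<close> in the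
  application.\<close>

definition hard_law ::
    "real \<Rightarrow> real \<Rightarrow> real \<Rightarrow> real \<Rightarrow> real \<Rightarrow> real \<Rightarrow> real \<Rightarrow> real set \<Rightarrow> (real \<Rightarrow> real) \<Rightarrow> bool" where
  "hard_law q s A h t r w V mu \<longleftrightarrow> output_law q h V mu \<and> 0 \<le> w \<and> w \<le> 1 \<and>
    w * (\<Sum>y\<in>V. mu y * \<bar>y\<bar> powr s) \<le> A \<and>
    w * (1 - output_law.affinity V mu) \<le> t / 8 \<and>
    r \<le> w * (output_law.mean_loss q V mu 0 - output_law.mean_loss q V mu h)"

text \<open>The condition \<open>w * p = t / 8\<close> makes the rare value \<open>B\<close> invisible. The size of \<open>B\<close> relative
  to \<open>p\<close> is dictated by \<open>h\<close> being optimal, and the moment condition then fixes \<open>w\<close> and \<open>p\<close>.\<close>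
lemma heavy_tail_law:
  assumes q: "q > 1" and s: "s \<ge> q" and b: "b > 0" and A: "A > 0"
  shows "\<exists>h c. 0 < h \<and> h \<le> b \<and> 0 < c \<and> (\<forall>t. 0 < t \<and> t \<le> 1 \<longrightarrow>
    (\<exists>w V mu. hard_law q s A h t (c * t powr (1 - (q - 1) / s)) w V mu))"
proof -
  \<comment> \<open>For the \<open>p\<close> below,
    \<open>(1 / p) powr (s / (q - 1)) = \<kappa> / t\<close>; the cap on \<open>h\<close> then keeps
    the moment bound \<open>(2 * h) powr s * \<kappa> / 8\<close> within \<open>A\<close>.\<close>
  define \<kappa> where "\<kappa> = (8::real) powr (s / (q - 1))"
  define h where "h = min b ((8 * A / \<kappa>) powr (1 / s) / 2)"
  have \<kappa>: "\<kappa> > 0" by (simp add: \<kappa>_def)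
  hence h: "0 < h" "h \<le> b" using b A by (auto simp: h_def)
  have "(2 * h) powr s \<le> ((8 * A / \<kappa>) powr (1 / s)) powr s"
    using h s q by (intro powr_mono2) (auto simp: h_def)
  also have "\<dots> = 8 * A / \<kappa>" using s q A \<kappa> by (simp add: powr_powr)
  finally have h_A: "(2 * h) powr s * \<kappa> / 8 \<le> A" using \<kappa> by (simp add: field_simps)
  have "\<exists>w V mu. hard_law q s A h t ((q - 1) * h powr q / 2 * t powr (1 - (q - 1) / s)) w V mu"
    if t: "0 < t" "t \<le> 1" for t
  proof -
    define p where "p = t powr ((q - 1) / s) / 8"
    define w where "w = t powr (1 - (q - 1) / s)"
    \<comment> \<open>As \<open>B - h = h * r\<close>, this choice solves the first-order condition
      \<open>p * (B - h) powr (q - 1) = (1 - p) * h powr (q - 1)\<close>.\<close>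
    define r where "r = ((1 - p) / p) powr (1 / (q - 1))"
    define B where "B = h * (1 + r)"
    define V where "V = {- B, 0, B}"
    define mu where "mu = (\<lambda>y. if y = B then p else if y = 0 then 1 - p else 0)"
    have p: "0 < p" "p \<le> 1 / 8"
      using t q s by (auto simp: p_def intro!: powr_le1)
    have w: "0 < w" "w \<le> 1"
      using t q s by (auto simp: w_def field_simps intro!: powr_le1)
    have wp: "w * p = t / 8"
      using t by (simp add: w_def p_def flip: powr_add)
    have r: "0 < r" using p by (simp add: r_def)
    have B: "0 < B" "B \<noteq> 0" "- B \<noteq> B" using h r by (auto simp: B_def)
    have sum_V: "(\<Sum>y\<in>V. f y) = f (- B) + f 0 + f B" for f :: "real \<Rightarrow> real"
      using B by (simp add: V_def)
    have mu_V: "mu (- B) = 0" "mu 0 = 1 - p" "mu B = p" using B by (auto simp: mu_def)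
    have stationary: "p * (B - h) powr (q - 1) = (1 - p) * h powr (q - 1)"
    proof -
      have "(B - h) powr (q - 1) = h powr (q - 1) * r powr (q - 1)"
        using h r by (simp add: B_def algebra_simps powr_mult)
      also have "r powr (q - 1) = (1 - p) / p" using p q by (simp add: r_def powr_powr)
      finally show ?thesis using p by simp
    qed
    have Bh: "B > h" using h r by (simp add: B_def)
    interpret output_law q h V mu
    proof
      have "(\<Sum>y\<in>V. mu y * (sgn (y - h) * \<bar>y - h\<bar> powr (q - 1))) = 0"
        using h Bh stationary by (simp add: sum_V mu_V sgn_if)
      thus "(\<Sum>y\<in>V. mu y * \<bar>y - h\<bar> powr q) \<le> (\<Sum>y\<in>V. mu y * \<bar>y - a\<bar> powr q)" for a
        using p by (intro powr_loss_minimal[OF q]) (auto simp: mu_def)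
      show "sum mu V = 1" by (simp add: sum_V mu_V)
    qed (use q p in \<open>auto simp: V_def mu_def\<close>)
    \<comment> \<open>\<open>mu (- B) = 0\<close>, so only the output \<open>0\<close> contributes
      to the affinity.\<close>
    have aff: "1 - affinity = p"
      using p by (simp add: affinity_def sum_V mu_V)
    have gap: "(q - 1) * h powr q / 2 \<le> mean_loss 0 - mean_loss h"
    proof -
      \<comment> \<open>The tangent at \<open>B - h\<close> is evaluated at \<open>B\<close>; the
        first-order condition turns its linear term, times \<open>p\<close>, into
        \<open>q * (1 - p) * h powr q\<close>.\<close>
      have "(B - h) powr q + q * (B - h) powr (q - 1) * (B - (B - h)) \<le> B powr q"
        using q B Bh by (intro powr_tangent_nonneg) auto
      hence "p * ((B - h) powr q + q * (B - h) powr (q - 1) * h) \<le> p * B powr q"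
        using p by (intro mult_left_mono) auto
      moreover have "p * (q * (B - h) powr (q - 1) * h) = q * (1 - p) * (h * h powr (q - 1))"
        using stationary by (simp add: mult_ac)
      moreover have "h * h powr (q - 1) = h powr q" using h powr_mult_base[of h "q - 1"] by simp
      moreover have "mean_loss 0 = p * B powr q" using B q by (simp add: mean_loss_def sum_V mu_V)
      moreover have "mean_loss h = (1 - p) * h powr q + p * (B - h) powr q"
        using h Bh by (simp add: mean_loss_def sum_V mu_V)
      ultimately have "(q - 1) * (1 - p) * h powr q \<le> mean_loss 0 - mean_loss h"
        by (simp add: algebra_simps)
      moreover have "(q - 1) * h powr q * (1 / 2) \<le> (q - 1) * h powr q * (1 - p)"
        using p q by (intro mult_left_mono) auto
      ultimately show ?thesis by (simp add: mult_ac)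
    qed
    have "w * (\<Sum>y\<in>V. mu y * \<bar>y\<bar> powr s) = t / 8 * B powr s"
      using wp B s q by (simp add: sum_V mu_V mult.assoc[symmetric])
    also have "\<dots> \<le> t / 8 * ((2 * h) powr s * (\<kappa> / t))"
    proof (intro mult_left_mono)
      \<comment> \<open>Both \<open>1\<close> and \<open>(1 - p) / p\<close> are at most
        \<open>1 / p\<close>, which bounds the two summands of \<open>1 + r\<close>.\<close>
      have "1 powr (1 / (q - 1)) \<le> (1 / p) powr (1 / (q - 1))"
        using p q by (intro powr_mono2) auto
      moreover have "r \<le> (1 / p) powr (1 / (q - 1))"
        unfolding r_def using p q by (intro powr_mono2) (auto simp: field_simps)
      ultimately have "1 + r \<le> 2 * (1 / p) powr (1 / (q - 1))" by simp
      hence "B \<le> 2 * h * (1 / p) powr (1 / (q - 1))"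
        unfolding B_def using mult_left_mono[of "1 + r" _ h] h by (simp add: mult_ac)
      hence "B powr s \<le> (2 * h * (1 / p) powr (1 / (q - 1))) powr s"
        using B s q by (intro powr_mono2) auto
      also have "\<dots> = (2 * h) powr s * (1 / p) powr (s / (q - 1))"
        using h p by (simp add: powr_mult powr_powr)
      also have "(1 / p) powr (s / (q - 1)) = \<kappa> / t"
        using t q s by (simp add: p_def \<kappa>_def powr_divide powr_powr)
      finally show "B powr s \<le> (2 * h) powr s * (\<kappa> / t)" .
    qed (use t in auto)
    also have "\<dots> = (2 * h) powr s * \<kappa> / 8" using t by simp
    also note h_A
    finally have moment: "w * (\<Sum>y\<in>V. mu y * \<bar>y\<bar> powr s) \<le> A" .
    have "(q - 1) * h powr q / 2 * w \<le> w * (mean_loss 0 - mean_loss h)"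
      using mult_right_mono[OF gap, of w] w by (simp add: mult_ac)
    hence "hard_law q s A h t ((q - 1) * h powr q / 2 * t powr (1 - (q - 1) / s)) w V mu"
      unfolding hard_law_def using output_law_axioms w moment wp aff by (simp add: w_def)
    thus ?thesis by blast
  qed
  moreover have "0 < (q - 1) * h powr q / 2" using q h by simp
  ultimately show ?thesis using h by blast
qed

section \<open>Elementary inequalities for the two-point law\<close>

lemma ratio_le_ln:
  fixes r :: real assumes "r \<ge> 1" shows "(r - 1) / (r + 1) \<le> ln r"
proof -
  have "(r - 1) / (r + 1) \<le> (r - 1) / r" using assms by (intro divide_left_mono) auto
  also have "\<dots> = 1 - 1 / r" using assms by (simp add: field_simps)
  also have "\<dots> \<le> ln r" using ln_le_minus_one[of "1 / r"] assms by (simp add: ln_div)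
  finally show ?thesis .
qed

lemma ln_ratio_le:
  fixes u :: real assumes "0 \<le> u" "u \<le> 1 / 2" shows "ln ((1 + u) / (1 - u)) \<le> 3 * u"
proof -
  have "ln ((1 + u) / (1 - u)) = ln (1 + u) + ln (1 / (1 - u))" using assms by (simp add: ln_div)
  also have "ln (1 / (1 - u)) \<le> 1 / (1 - u) - 1" using assms by (intro ln_le_minus_one) auto
  also have "ln (1 + u) \<le> u" using assms by (intro ln_add_one_self_le_self) auto
  also have "1 / (1 - u) - 1 \<le> 2 * u" using assms mult_left_le[of "2 * u" u] by (simp add: field_simps)
  finally show ?thesis by simp
qed

text \<open>The detour through \<open>exp (- (a * v))\<close> treats exponents below and above one
  alike; \<open>v < 1\<close> bounds \<open>1 + a * v\<close> by \<open>1 + a\<close>.\<close>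

lemma one_minus_powr_ge:
  fixes v a :: real assumes "0 \<le> v" "v < 1" "a > 0"
  shows "a / (1 + a) * v \<le> 1 - (1 - v) powr a"
proof -
  have "(1 - v) powr a \<le> exp (- (a * v))"
    using assms ln_le_minus_one[of "1 - v"] mult_left_mono[of "ln (1 - v)" "- v" a] by (simp add: powr_def)
  also have "\<dots> \<le> 1 / (1 + a * v)"
    using assms exp_ge_add_one_self[of "a * v"] by (simp add: exp_minus field_simps add_pos_nonneg)
  finally have "1 - 1 / (1 + a * v) \<le> 1 - (1 - v) powr a" by simp
  moreover have "a / (1 + a) * v \<le> a * v / (1 + a * v)"
    using assms by (auto intro!: divide_left_mono mult_pos_pos add_pos_nonneg simp: mult_left_le)
  moreover have "a * v / (1 + a * v) = 1 - 1 / (1 + a * v)"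
  proof -
    have "1 + a * v > 0" using assms by (simp add: add_pos_nonneg)
    thus ?thesis by (simp add: field_simps)
  qed
  ultimately show ?thesis by simp
qed

lemma harmonic_le_geometric_mean:
  fixes x y :: real assumes "x > 0" "y > 0" shows "2 * x * y / (x + y) \<le> sqrt (x * y)"
proof -
  have "2 * sqrt (x * y) \<le> x + y" using arith_geo_mean_sqrt[of x y] assms by simp
  hence "sqrt (x * y) * (2 * sqrt (x * y)) \<le> sqrt (x * y) * (x + y)"
    using assms by (intro mult_left_mono) auto
  thus ?thesis using assms by (simp add: field_simps)
qed

text \<open>The bias \<open>\<delta>\<close> for which \<open>h\<close> is optimal is of order \<open>h / B\<close>; the choice of \<open>w\<close> and \<open>B\<close> makes
  both \<open>w * B powr s\<close> and \<open>w * \<delta>\<^sup>2 / t\<close> of order one.\<close>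
lemma two_point_law:
  assumes q: "q > 1" and s: "s \<ge> q" and b: "b > 0" and A: "A > 0"
  shows "\<exists>h c. 0 < h \<and> h \<le> b \<and> 0 < c \<and> (\<forall>t. 0 < t \<and> t \<le> 1 \<longrightarrow>
    (\<exists>w V mu. hard_law q s A h t (c * t powr (1 - q / (s + 2))) w V mu))"
proof -
  \<comment> \<open>As \<open>\<beta> powr s = A\<close>, the moment \<open>w * B powr s\<close>
    will be exactly \<open>A\<close>.\<close>
  define \<beta> where "\<beta> = A powr (1 / s)"
  \<comment> \<open>The cap \<open>\<beta> / 2\<close> yields \<open>u \<le> 1 / 2\<close>, the cap
    \<open>\<beta> / (9 * (q - 1))\<close> yields \<open>\<delta> \<le> 1 / (3 * T)\<close>.\<close>
  define h where "h = min b (min (\<beta> / 2) (\<beta> / (9 * (q - 1))))"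
  define c where "c = (q - 1) / (q + 1) * h\<^sup>2 * \<beta> powr (q - 2)"
  have \<beta>: "\<beta> > 0" using A by (simp add: \<beta>_def)
  have "h \<le> \<beta> / 2" unfolding h_def by (rule min.coboundedI2) (rule min.cobounded1)
  moreover have "h \<le> \<beta> / (9 * (q - 1))" unfolding h_def by (rule min.coboundedI2) (rule min.cobounded2)
  moreover have "0 < h" "h \<le> b" using b q \<beta> by (auto simp: h_def)
  ultimately have h: "0 < h" "h \<le> b" "h \<le> \<beta> / 2" "h \<le> \<beta> / (9 * (q - 1))" by auto
  have "\<exists>w V mu. hard_law q s A h t (c * t powr (1 - q / (s + 2))) w V mu"
    if t: "0 < t" "t \<le> 1" for t
  proof -
    \<comment> \<open>The exponent solves \<open>T powr (- s) / T\<^sup>2 = t\<close>.\<close>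
    define T where "T = t powr (- 1 / (s + 2))"
    define w where "w = T powr (- s)"
    define B where "B = \<beta> * T"
    define u where "u = h / B"
    define X where "X = (B - h) powr (q - 1)"
    define Y where "Y = (B + h) powr (q - 1)"
    \<comment> \<open>The solution of the first-order condition
      \<open>(1 + \<delta>) * X = (1 - \<delta>) * Y\<close> at \<open>h\<close>.\<close>
    define \<delta> where "\<delta> = (Y - X) / (Y + X)"
    define V where "V = {- B, 0, B}"
    define mu where "mu = (\<lambda>y. if y = B then (1 + \<delta>) / 2 else if y = 0 then 0 else (1 - \<delta>) / 2)"
    have T: "T \<ge> 1" using t q s powr_mono'[of "- 1 / (s + 2)" 0 t] by (simp add: T_def)
    have w: "0 < w" "w \<le> 1"
      using T q s powr_mono[of "- s" 0 T] by (auto simp: w_def)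
    have "\<beta> * 1 \<le> B" unfolding B_def using T \<beta> by (intro mult_left_mono) auto
    hence B: "0 < B" "B \<noteq> 0" "- B \<noteq> B" "\<beta> \<le> B" using \<beta> by auto
    have u: "0 < u" "u \<le> 1 / 2" "h = B * u" using h B by (auto simp: u_def field_simps)
    have Bh: "h < B" using h B by simp
    have XY: "0 < X" "X \<le> Y" "0 < Y"
      using h Bh q by (auto simp: X_def Y_def intro!: powr_mono2)
    have \<delta>: "0 \<le> \<delta>" "\<delta> \<le> 1" "1 + \<delta> = 2 * Y / (X + Y)" "1 - \<delta> = 2 * X / (X + Y)"
      using XY by (auto simp: \<delta>_def field_simps)
    have sum_V: "(\<Sum>y\<in>V. f y) = f (- B) + f 0 + f B" for f :: "real \<Rightarrow> real"
      using B by (simp add: V_def)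
    have mu_V: "mu (- B) = (1 - \<delta>) / 2" "mu 0 = 0" "mu B = (1 + \<delta>) / 2" using B by (auto simp: mu_def)
    have X_h: "\<bar>B - h\<bar> powr (q - 1) = X" and Y_h: "\<bar>- B - h\<bar> powr (q - 1) = Y"
      using Bh h by (auto simp: X_def Y_def add.commute)
    interpret output_law q h V mu
    proof
      have "(\<Sum>y\<in>V. mu y * (sgn (y - h) * \<bar>y - h\<bar> powr (q - 1))) = (1 + \<delta>) / 2 * X - (1 - \<delta>) / 2 * Y"
        unfolding sum_V mu_V X_h Y_h using Bh h by (simp add: sgn_if)
      also have "\<dots> = 0" unfolding \<delta> by (simp add: mult_ac)
      finally show "(\<Sum>y\<in>V. mu y * \<bar>y - h\<bar> powr q) \<le> (\<Sum>y\<in>V. mu y * \<bar>y - a\<bar> powr q)" for a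
        using \<delta>(1,2) by (intro powr_loss_minimal[OF q]) (auto simp: mu_def)
      show "sum mu V = 1" by (simp add: sum_V mu_V field_simps)
    qed (use q \<delta>(1,2) in \<open>auto simp: V_def mu_def\<close>)
    have \<delta>_u: "\<delta> \<le> 3 * (q - 1) * u"
    proof -
      define r where "r = ((1 + u) / (1 - u)) powr (q - 1)"
      have "B + h = (B - h) * ((1 + u) / (1 - u))" using u(2) by (simp add: u(3) field_simps)
      hence "Y = X * r" using u(1,2) Bh unfolding X_def Y_def r_def by (subst powr_mult[symmetric]) auto
      hence "\<delta> = X * (r - 1) / (X * (r + 1))" unfolding \<delta>_def by (simp add: algebra_simps)
      also have "\<dots> = (r - 1) / (r + 1)" using XY by simp
      also have "\<dots> \<le> ln r"
        using u q unfolding r_def by (intro ratio_le_ln ge_one_powr_ge_zero) auto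
      also have "\<dots> = (q - 1) * ln ((1 + u) / (1 - u))" using u by (simp add: r_def ln_powr)
      also have "\<dots> \<le> (q - 1) * (3 * u)" using u q by (intro mult_left_mono ln_ratio_le) auto
      finally show ?thesis by (simp only: mult_ac)
    qed
    \<comment> \<open>The affinity is \<open>sqrt (1 - \<delta>\<^sup>2)\<close>, and a number in
      the unit interval is at most its root.\<close>
    have aff: "1 - affinity \<le> \<delta>\<^sup>2"
    proof -
      have "affinity = sqrt ((1 - \<delta>\<^sup>2) / 4) + sqrt ((1 - \<delta>\<^sup>2) / 4)"
        by (simp add: affinity_def sum_V mu_V power2_eq_square algebra_simps)
      also have "\<dots> = sqrt (1 - \<delta>\<^sup>2)" by (simp add: real_sqrt_divide)
      also have "\<dots> \<ge> 1 - \<delta>\<^sup>2"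
      proof -
        have "(1 - \<delta>\<^sup>2) * (1 - \<delta>\<^sup>2) \<le> 1 - \<delta>\<^sup>2"
          using \<delta>(1,2) by (intro mult_left_le) (auto simp: power_le_one)
        thus ?thesis by (intro real_le_rsqrt) (simp add: power2_eq_square)
      qed
      finally show ?thesis by simp
    qed
    have T_t: "w * (1 / T\<^sup>2) = t"
    proof -
      have "w * (1 / T\<^sup>2) = T powr (- s) * T powr (- 2)"
        using T by (simp add: w_def powr_minus powr_numeral divide_inverse)
      also have "\<dots> = T powr (- (s + 2))" by (simp flip: powr_add)
      also have "\<dots> = t"
      proof -
        have "- 1 / (s + 2) * (- (s + 2)) = 1" using q s by (simp add: field_simps)
        thus ?thesis unfolding T_def powr_powr using t by simp
      qed
      finally show ?thesis .
    qed
    have close: "w * (1 - affinity) \<le> t / 8"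
    proof -
      have "3 * (q - 1) * u = 9 * (q - 1) * h / (3 * T * \<beta>)"
        using T \<beta> by (simp add: u_def B_def field_simps)
      also have "\<dots> \<le> \<beta> / (3 * T * \<beta>)"
        using h(4) q T \<beta> by (intro divide_right_mono) (simp_all add: field_simps)
      also have "\<dots> = 1 / (3 * T)" using \<beta> by simp
      finally have "\<delta> \<le> 1 / (3 * T)" using \<delta>_u by linarith
      hence "\<delta>\<^sup>2 \<le> (1 / (3 * T))\<^sup>2" using \<delta>(1) by (intro power_mono)
      hence "w * (1 - affinity) \<le> w * (1 / (3 * T))\<^sup>2" using aff w by (intro mult_left_mono) auto
      also have "\<dots> = t / 9" unfolding T_t[symmetric] by (simp add: power2_eq_square)
      finally show ?thesis using t by simp
    qed
    have gap: "(q - 1) / (q + 1) * u\<^sup>2 * B powr q \<le> mean_loss 0 - mean_loss h"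
    proof -
      have Z: "B * B powr (q - 1) = B powr q" using B powr_mult_base[of B "q - 1"] by simp
      have "mean_loss h = (1 + \<delta>) / 2 * (B - h) powr q + (1 - \<delta>) / 2 * (B + h) powr q"
        using Bh h by (simp add: mean_loss_def sum_V mu_V add.commute)
      also have "(B - h) powr q = (B - h) * X" using Bh powr_mult_base[of "B - h" "q - 1"] by (simp add: X_def)
      also have "(B + h) powr q = (B + h) * Y" using B h powr_mult_base[of "B + h" "q - 1"] by (simp add: Y_def)
      \<comment> \<open>The terms in \<open>h\<close> cancel and leave \<open>B\<close> times the
        harmonic mean of \<open>X\<close> and \<open>Y\<close>. Their geometric mean is explicit, as
        \<open>(B - h) * (B + h) = B\<^sup>2 * (1 - u\<^sup>2)\<close>.\<close>
      also have "(1 + \<delta>) / 2 * ((B - h) * X) + (1 - \<delta>) / 2 * ((B + h) * Y) = B * (2 * X * Y / (X + Y))"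
      proof -
        have "2 * Y / S / 2 * ((B - h) * X) + 2 * X / S / 2 * ((B + h) * Y) = B * (2 * X * Y / S)"
          if "S > 0" for S using that by (simp add: field_simps)
        from this[of "X + Y"] XY show ?thesis unfolding \<delta> by simp
      qed
      also have "\<dots> \<le> B * sqrt (X * Y)"
        using B XY by (intro mult_left_mono harmonic_le_geometric_mean) auto
      also have "sqrt (X * Y) = B powr (q - 1) * (1 - u\<^sup>2) powr ((q - 1) / 2)"
      proof -
        have "X * Y = ((B - h) * (B + h)) powr (q - 1)" using Bh h by (simp add: X_def Y_def powr_mult)
        also have "(B - h) * (B + h) = B\<^sup>2 * (1 - u\<^sup>2)"
          by (simp add: u(3) power2_eq_square algebra_simps)
        finally have "sqrt (X * Y) = ((B\<^sup>2 * (1 - u\<^sup>2)) powr (q - 1)) powr (1 / 2)"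
          by (simp add: powr_half_sqrt)
        also have "\<dots> = (B\<^sup>2 * (1 - u\<^sup>2)) powr ((q - 1) / 2)" by (simp add: powr_powr)
        also have "\<dots> = (B\<^sup>2) powr ((q - 1) / 2) * (1 - u\<^sup>2) powr ((q - 1) / 2)"
          using B u by (intro powr_mult)
        also have "(B\<^sup>2) powr ((q - 1) / 2) = B powr (q - 1)"
        proof -
          have "(B\<^sup>2) powr ((q - 1) / 2) = (B powr 2) powr ((q - 1) / 2)" using B by simp
          also have "\<dots> = B powr (2 * ((q - 1) / 2))" by (rule powr_powr)
          also have "2 * ((q - 1) / 2) = q - 1" by (simp add: field_simps)
          finally show ?thesis .
        qed
        finally show ?thesis .
      qed
      finally have mean_h: "mean_loss h \<le> B powr q * (1 - u\<^sup>2) powr ((q - 1) / 2)"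
        using Z by (simp add: mult.assoc[symmetric])
      have "(q - 1) / 2 / (1 + (q - 1) / 2) * u\<^sup>2 \<le> 1 - (1 - u\<^sup>2) powr ((q - 1) / 2)"
        using q u by (intro one_minus_powr_ge) (auto simp: power_less_one_iff)
      moreover have "(q - 1) / 2 / (1 + (q - 1) / 2) = (q - 1) / (q + 1)" using q by (simp add: field_simps)
      ultimately have "(q - 1) / (q + 1) * u\<^sup>2 \<le> 1 - (1 - u\<^sup>2) powr ((q - 1) / 2)" by (simp only:)
      hence "(q - 1) / (q + 1) * u\<^sup>2 * B powr q \<le> (1 - (1 - u\<^sup>2) powr ((q - 1) / 2)) * B powr q"
        by (rule mult_right_mono) simp
      also have "\<dots> = B powr q - B powr q * (1 - u\<^sup>2) powr ((q - 1) / 2)"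
        by (simp add: algebra_simps)
      also have "\<dots> \<le> mean_loss 0 - mean_loss h"
      proof -
        have "mean_loss 0 = B powr q" using B by (simp add: mean_loss_def sum_V mu_V field_simps)
        thus ?thesis using mean_h by simp
      qed
      finally show ?thesis .
    qed
    have moment: "w * (\<Sum>y\<in>V. mu y * \<bar>y\<bar> powr s) \<le> A"
    proof -
      have "w * (\<Sum>y\<in>V. mu y * \<bar>y\<bar> powr s) = T powr (- s) * B powr s"
        using B by (simp add: sum_V mu_V w_def field_simps)
      also have "\<dots> = \<beta> powr s" using \<beta> T by (simp add: B_def powr_mult powr_minus)
      also have "\<dots> = A" using A s q by (simp add: \<beta>_def powr_powr)
      finally show ?thesis by simp
    qed
    \<comment> \<open>Apart from constants the bound is \<open>T powr (q - 2 - s)\<close>, the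
      required power of \<open>t\<close>.\<close>
    have "w * ((q - 1) / (q + 1) * u\<^sup>2 * B powr q) = (q - 1) / (q + 1) * h\<^sup>2 * (w * (B powr q / B\<^sup>2))"
      by (simp add: u_def power_divide)
    also have "B powr q / B\<^sup>2 = B powr (q - 2)" using B by (simp add: powr_diff powr_numeral)
    also have "B powr (q - 2) = \<beta> powr (q - 2) * T powr (q - 2)" using \<beta> T by (simp add: B_def powr_mult)
    also have "w * (\<beta> powr (q - 2) * T powr (q - 2)) = \<beta> powr (q - 2) * T powr (q - 2 - s)"
    proof -
      have "T powr (- s) * T powr (q - 2) = T powr (q - 2 - s)" by (simp flip: powr_add)
      thus ?thesis by (simp add: w_def mult.left_commute)
    qed
    also have "T powr (q - 2 - s) = t powr (1 - q / (s + 2))"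
    proof -
      have "- 1 / (s + 2) * (q - 2 - s) = 1 - q / (s + 2)" using q s by (simp add: field_simps)
      thus ?thesis unfolding T_def powr_powr by simp
    qed
    finally have "w * ((q - 1) / (q + 1) * u\<^sup>2 * B powr q) = c * t powr (1 - q / (s + 2))"
      by (simp add: c_def)
    hence "c * t powr (1 - q / (s + 2)) \<le> w * (mean_loss 0 - mean_loss h)"
      using mult_left_mono[OF gap, of w] w by simp
    hence "hard_law q s A h t (c * t powr (1 - q / (s + 2))) w V mu"
      unfolding hard_law_def using output_law_axioms w moment close by simp
    thus ?thesis by blast
  qed
  moreover have "0 < c" using q h \<beta> by (simp add: c_def)
  ultimately show ?thesis using h by blast
qed

section \<open>The lower bound\<close>

text \<open>The available points are \<open>k\<close> informative ones and one more. The bound on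
  \<open>ln\<close> follows from \<open>log 2 d < k + 1 \<le> 2 * k\<close> and
  \<open>ln 2 \<le> 1\<close>.\<close>

lemma log2_floor_bounds:
  fixes d :: nat assumes "d \<ge> 2"
  defines "k \<equiv> nat \<lfloor>log 2 (real d)\<rfloor>"
  shows "k \<ge> 1" "2 ^ k \<le> d" "ln (real d) \<le> 2 * real k" "\<lfloor>log 2 (2 * real d)\<rfloor> = int (Suc k)"
proof -
  have log_ge: "log 2 (real d) \<ge> 1" using assms by (simp add: le_log_iff)
  hence k: "int k = \<lfloor>log 2 (real d)\<rfloor>" by (simp add: k_def)
  with log_ge show k1: "k \<ge> 1" by linarith
  have "2 powr real k \<le> real d" using k assms by (subst le_log_iff[symmetric]) linarith+
  thus "2 ^ k \<le> d" by (simp add: powr_realpow) 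
  have "log 2 (real d) \<le> 2 * real k" using k k1 by linarith
  hence "ln (real d) \<le> 2 * real k * ln 2" by (simp add: log_def field_simps)
  also have "\<dots> \<le> 2 * real k * 1" using ln_le_minus_one[of 2] by (intro mult_left_mono) auto
  finally show "ln (real d) \<le> 2 * real k" by simp
  have "log 2 (2 * real d) = 1 + log 2 (real d)" using assms by (simp add: log_mult)
  thus "\<lfloor>log 2 (2 * real d)\<rfloor> = int (Suc k)" using k by simp
qed

lemma lower_bound_holds_count_space:
  assumes q: "q > 1" and s: "s \<ge> q" and b: "b > 0" and A: "A > 0"
  shows "\<exists>C>0. \<forall>d\<ge>2. \<forall>n\<ge>1.
    lower_bound_holds C b A q s d n (count_space {..nat \<lfloor>log 2 (real d)\<rfloor>})"
proof -
  \<comment> \<open>\<open>e\<close> is the smaller of the two exponents, hence gives the larger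
    rate for \<open>t \<le> 1\<close>.\<close>
  obtain h c e where h: "0 < h" "h \<le> b" and c: "0 < c"
    and e: "e \<le> 1 - (q - 1) / s" "e \<le> 1 - q / (s + 2)"
    and law: "\<And>t. 0 < t \<Longrightarrow> t \<le> 1 \<Longrightarrow> \<exists>w V mu. hard_law q s A h t (c * t powr e) w V mu"
  proof (cases "q / (s + 2) \<le> (q - 1) / s")
    case True
    with heavy_tail_law[OF assms] that[of _ _ "1 - (q - 1) / s"] show thesis by auto
  next
    case False
    with two_point_law[OF assms] that[of _ _ "1 - q / (s + 2)"] show thesis by auto
  qed
  have "lower_bound_holds (c / 4) b A q s d n (count_space {..nat \<lfloor>log 2 (real d)\<rfloor>})"
    if d: "d \<ge> 2" and n: "n \<ge> 1" for d n
  proof -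
    define k where "k = nat \<lfloor>log 2 (real d)\<rfloor>"
    define t where "t = min (ln (real d) / real n) 1"
    note kd = log2_floor_bounds[OF d, folded k_def]
    have t: "0 < t" "t \<le> 1" using d n by (auto simp: t_def)
    obtain w V mu where *: "hard_law q s A h t (c * t powr e) w V mu" using law[OF t] by blast
    then interpret output_law q h V mu by (simp add: hard_law_def)
    interpret sign_cube q h V mu w k using * kd by unfold_locales (auto simp: hard_law_def)
    have "real n * (w * (1 - affinity)) \<le> real n * (t / 8)"
      using * n by (intro mult_left_mono) (auto simp: hard_law_def)
    also have "\<dots> \<le> ln (real d) / 8" using n by (auto simp: t_def min_def field_simps)
    also have "\<dots> \<le> real k / 4" using kd(3) by linarith
    finally have close: "real n * (w * (1 - affinity)) \<le> real k / 4" .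
    have rate: "c / 4 * t powr e' \<le> w * (mean_loss 0 - mean_loss h) / 4" if "e \<le> e'" for e'
    proof -
      have "c * t powr e' \<le> c * t powr e" using c t that by (intro mult_left_mono powr_mono') auto
      thus ?thesis using * by (simp add: hard_law_def)
    qed
    show ?thesis unfolding k_def[symmetric]
      by (rule lower_bound_holds_cube[OF h n kd(2) close])
        (use * rate e in \<open>auto simp: hard_law_def t_def\<close>)
  qed
  thus ?thesis using c by (intro exI[of _ "c / 4"]) auto
qed

text \<open>For one function both rates vanish, since \<open>ln 1 = 0\<close> and
  \<open>0 powr a = 0\<close> for all \<open>a\<close>. A point mass with output \<open>0\<close>
  gives the zero function risk \<open>0\<close>, so the excess risk is nonnegative.\<close>

lemma lower_bound_holds_singleton:
  fixes M :: "'a measure"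
  assumes A: "A > 0" and b: "b > 0" and x: "x \<in> space M"
  shows "lower_bound_holds C b A q s 1 n M"
proof -
  define g where "g = (\<lambda>x\<in>space M. 0 :: real)"
  define P where "P = return (M \<Otimes>\<^sub>M (borel :: real measure)) (x, 0)"
  have P: "P \<in> data_distributions M"
    using x by (auto simp: data_distributions_def P_def space_pair_measure intro!: prob_space_return)
  have moment: "output_moment s P = 0"
    unfolding output_moment_def P_def case_prod_beta
    using x by (subst nn_integral_return) (auto simp: space_pair_measure)
  have g[measurable]: "g \<in> borel_measurable M"
    using measurable_cong[of M g "\<lambda>_. 0" borel] by (simp add: g_def)
  have "risk q P g = 0"
  proof -
    have "g x = 0" using x by (simp add: g_def)
    thus ?thesis unfolding risk_def P_def case_prod_beta using x
      by (subst nn_integral_return) (auto simp: space_pair_measure)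
  qed
  hence "excess_risk q n P {g} ghat \<ge> 0" for ghat
    by (simp add: excess_risk_def zero_ennreal.rep_eq)
  thus ?thesis unfolding lower_bound_holds_def using P moment A b g
    by (intro exI[of _ "{g}"]) (auto simp: prediction_functions_def g_def zero_ereal_def[symmetric] intro!: bexI[of _ P])
qed

lemma lower_bound_holds_points:
  fixes M :: "'a measure"
  assumes small: "\<forall>d\<ge>2. \<forall>n\<ge>1.
      lower_bound_holds C b A q s d n (count_space {..nat \<lfloor>log 2 (real d)\<rfloor>} :: nat measure)"
    and b: "b > 0" and A: "A > 0" and d: "d \<ge> 1" and n: "n \<ge> 1"
    and M: "contains_points M \<lfloor>log 2 (2 * real d)\<rfloor>"
  shows "lower_bound_holds C b A q s d n M"
proof (cases "d = 1")
  case True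
  with M obtain S where "S \<subseteq> space M" "card S \<ge> 1" by (auto simp: contains_points_def)
  then obtain x where "x \<in> space M" by (metis card.empty not_one_le_zero ex_in_conv subsetD)
  from lower_bound_holds_singleton[OF A b this] True show ?thesis by simp
next
  case False
  define k where "k = nat \<lfloor>log 2 (real d)\<rfloor>"
  have d2: "d \<ge> 2" using d False by simp
  have "contains_points M (int (Suc k))" using M log2_floor_bounds(4)[OF d2] by (simp add: k_def)
  then obtain phi psi where retract: "phi \<in> measurable M (count_space {..k})"
      "psi \<in> measurable (count_space {..k}) M" "\<And>i. i \<le> k \<Longrightarrow> phi (psi i) = i"
    by (rule contains_points_retract) blast
  have "lower_bound_holds C b A q s d n (count_space {..k})" using small d2 n by (simp add: k_def)
  thus ?thesis using retract(1,2) by (rule lower_bound_holds_retract) (simp add: retract(3))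
qed

text \<open>A number admissible in the definition of \<open>lower_bound_const\<close>, which speaks of spaces of
  natural numbers only, serves the finite spaces \<open>{..k}\<close>, and these are retracts of all others.\<close>
theorem theorem8p6:
  fixes b A q s :: real
  assumes "q > 1" and "s \<ge> q" and "b > 0" and "A > 0"
  shows "lower_bound_const b A q s > 0 \<and>
    (\<forall>d \<ge> 1. \<forall>n \<ge> 1. \<forall>M :: 'a measure.
      contains_points M \<lfloor>log 2 (2 * real d)\<rfloor> \<longrightarrow>
      lower_bound_holds (lower_bound_const b A q s) b A q s d n M)"
proof -
  let ?P = "\<lambda>C. C > 0 \<and> (\<forall>d \<ge> 1. \<forall>n \<ge> 1. \<forall>M :: nat measure.
    contains_points M \<lfloor>log 2 (2 * real d)\<rfloor> \<longrightarrow> lower_bound_holds C b A q s d n M)"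
  have "\<exists>C. ?P C"
  proof -
    obtain C where C: "C > 0" "\<forall>d\<ge>2. \<forall>n\<ge>1.
        lower_bound_holds C b A q s d n (count_space {..nat \<lfloor>log 2 (real d)\<rfloor>})"
      using lower_bound_holds_count_space[OF assms] by blast
    thus ?thesis using lower_bound_holds_points[OF C(2) assms(3,4)] by blast
  qed
  \<comment> \<open>The chosen constant may differ from \<open>C\<close>; only the property
    \<open>?P\<close> is known of it, so the bounds on \<open>{..k}\<close> are recovered from
    \<open>?P\<close>.\<close>
  hence const: "?P (lower_bound_const b A q s)"
    unfolding lower_bound_const_def by (rule someI_ex)
  have "lower_bound_holds (lower_bound_const b A q s) b A q s d n
      (count_space {..nat \<lfloor>log 2 (real d)\<rfloor>} :: nat measure)" if d: "d \<ge> 2" and n: "n \<ge> 1" for d n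
  proof -
    define k where "k = nat \<lfloor>log 2 (real d)\<rfloor>"
    have "contains_points (count_space {..k}) (int (Suc k))"
      unfolding contains_points_def by (intro exI[of _ "{..k}"]) auto
    thus ?thesis using const d n log2_floor_bounds(4)[OF d] by (simp add: k_def)
  qed
  hence small: "\<forall>d\<ge>2. \<forall>n\<ge>1. lower_bound_holds (lower_bound_const b A q s) b A q s d n
      (count_space {..nat \<lfloor>log 2 (real d)\<rfloor>} :: nat measure)" by simp
  show ?thesis using const lower_bound_holds_points[OF small assms(3,4)] by blast
qed

end
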